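(* For every real $\rho\ge 0$, $$\zeta_R\cdot\frac{1}{f(\rho)}=a(\rho)\,\zeta'_R+b(\rho)\,\zeta'_I,\qquad \zeta_I\cdot\frac{1}{f(\rho)}=b(\rho)\,\zeta'_R+c(\rho)\,\zeta'_I,$$ where $$a(\rho)=-\tfrac12\cos(\rho\ln\pi)+\tfrac12+\frac{F_I F_R\sin(\rho\ln\pi)+F_R^2\cos(\rho\ln\pi)}{|F|^2},$$ $$b(\rho)=-\tfrac12\sin(\rho\ln\pi)+\frac{-F_I F_R\cos(\rho\ln\pi)+F_R^2\sin(\rho\ln\pi)}{|F|^2},\qquad c(\rho)=1-a(\rho).$$ Moreover this linear transformation is singular: $a(\rho)c(\rho)-b(\rho)^2=0$ for every $\rho\ge0$.
   Context: $\zeta$ is the Riemann zeta function and $\zeta'=d\zeta/ds$ its complex derivative. For real $\rho$ write $\zeta_R=\mathrm{Re}\,\zeta(1/2+i\rho)$, $\zeta_I=\mathrm{Im}\,\zeta(1/2+i\rho)$, $\zeta'_R=\mathrm{Re}\,\zeta'(1/2+i\rho)$, $\zeta'_I=\mathrm{Im}\,\zeta'(1/2+i\rho)$, and $F=\Gamma(1/4+i\rho/2)$, $F_R=\mathrm{Re}\,F$, $F_I=\mathrm{Im}\,F$. With $\psi=\Gamma'/\Gamma$ the digamma function, $$\frac{1}{f(\rho)}=\frac{2\ln(2\pi)\cosh(\pi\rho)-2\,\mathrm{Re}(\psi(1/2+i\rho))\cosh(\pi\rho)+\pi}{4\cosh(\pi\rho)}.$$ *)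

theory Defs
  imports "HOL-Analysis.Analysis"
begin

(* The Dirichlet series on Re s > 1 and holomorphy on the punctured plane determine the function
   on -{1} by analytic continuation; the clause f 1 = 0 only fixes the junk value at the pole,
   which makes the description unique. *)
definition riemann_zeta :: "complex \<Rightarrow> complex" where
  "riemann_zeta = (THE f. f holomorphic_on (- {1}) \<and>
     (\<forall>s. Re s > 1 \<longrightarrow> (\<lambda>n. 1 / of_nat (Suc n) powr s) sums f s) \<and> f 1 = 0)"

definition crit :: "real \<Rightarrow> complex" where
  "crit \<rho> = 1/2 + \<i> * of_real \<rho>"

definition zetaR :: "real \<Rightarrow> real" where
  "zetaR \<rho> = Re (riemann_zeta (crit \<rho>))"

definition zetaI :: "real \<Rightarrow> real" where
  "zetaI \<rho> = Im (riemann_zeta (crit \<rho>))"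

(* deriv is the complex derivative d/ds, not the derivative in \<rho>. *)
definition zetaR' :: "real \<Rightarrow> real" where
  "zetaR' \<rho> = Re (deriv riemann_zeta (crit \<rho>))"

definition zetaI' :: "real \<Rightarrow> real" where
  "zetaI' \<rho> = Im (deriv riemann_zeta (crit \<rho>))"

definition gammaF :: "real \<Rightarrow> complex" where
  "gammaF \<rho> = Gamma (1/4 + \<i> * of_real \<rho> / 2)"

(* This is 1/f itself: it changes sign for some \<rho> > 0, and f is undefined at its zeros. *)
definition recip_f :: "real \<Rightarrow> real" where
  "recip_f \<rho> =
     (2 * ln (2 * pi) * cosh (pi * \<rho>) - 2 * Re (Digamma (crit \<rho>)) * cosh (pi * \<rho>) + pi)
       / (4 * cosh (pi * \<rho>))"

definition coeff_a :: "real \<Rightarrow> real" where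
  "coeff_a \<rho> = - (1/2) * cos (\<rho> * ln pi) + 1/2
     + (Im (gammaF \<rho>) * Re (gammaF \<rho>) * sin (\<rho> * ln pi) + (Re (gammaF \<rho>))\<^sup>2 * cos (\<rho> * ln pi))
         / (cmod (gammaF \<rho>))\<^sup>2"

definition coeff_b :: "real \<Rightarrow> real" where
  "coeff_b \<rho> = - (1/2) * sin (\<rho> * ln pi)
     + (- Im (gammaF \<rho>) * Re (gammaF \<rho>) * cos (\<rho> * ln pi) + (Re (gammaF \<rho>))\<^sup>2 * sin (\<rho> * ln pi))
         / (cmod (gammaF \<rho>))\<^sup>2"

definition coeff_c :: "real \<Rightarrow> real" where
  "coeff_c \<rho> = 1 - coeff_a \<rho>"

end

theory Submission
  imports Defs "HOL-Complex_Analysis.Complex_Analysis"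
begin

text \<open>
  The functional equation \<open>\<zeta>(s) = \<chi>(s) \<zeta>(1 - s)\<close> with \<open>\<chi>(s) = 2 (2\<pi>)\<^sup>s\<^sup>-\<^sup>1 sin (\<pi>s/2) \<Gamma>(1 - s)\<close> reads
  \<open>\<zeta> = \<chi> cnj \<zeta>\<close> on the critical line, since there \<open>1 - s = cnj s\<close>. Differentiating it gives
  \<open>\<zeta>' + \<chi> cnj \<zeta>' = (\<chi>'/\<chi>) \<zeta>\<close>, where \<open>\<chi>'/\<chi> = 2/f\<close> is real and
  \<open>\<chi> = \<pi>\<^sup>i\<^sup>\<rho> cnj F / F = (2a - 1) + 2b\<i>\<close> has modulus 1. Real and imaginary parts are the two linear
  equations, and \<open>|\<chi>| = 1\<close> is the vanishing of the determinant.

  The continuation of \<open>\<zeta>\<close> and its functional equation come from the Mellin transform of \<open>1/(e\<^sup>x - 1)\<close>. For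
  real \<open>s\<close> in \<open>(-1, 0)\<close>, \<open>\<Gamma>(s) \<zeta>(s)\<close> is the Mellin transform of
  \<open>1/(e\<^sup>x - 1) - 1/x + 1/2 = (\<Sum>n\<ge>1. 2x / (x\<^sup>2 + 4\<pi>\<^sup>2n\<^sup>2))\<close>, whose terms have nonnegative integrals
  computed by the Beta function; the identity theorem extends the result to complex \<open>s\<close>.
\<close>

section \<open>Partial fractions of the cotangent\<close>

text \<open>Logarithmic derivative of the reflection formula: off the integers
  \<open>Gamma z * Gamma (1 - z) * sin (of_real pi * z)\<close> is the constant pi, so the
  derivative computed by the product rule vanishes.\<close>

lemma Digamma_reflection_complex:
  fixes z :: complex
  assumes "z \<notin> \<int>"
  shows "Digamma (1 - z) - Digamma z = of_real pi * cot (of_real pi * z)"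
proof -
  have nz: "z \<notin> \<int>\<^sub>\<le>\<^sub>0" "1 - z \<notin> \<int>\<^sub>\<le>\<^sub>0"
    using assms by (auto elim!: nonpos_Ints_cases simp: diff_eq_eq)
      (metis Ints_1 Ints_diff Ints_of_int diff_eq_eq add.commute)
  have s0: "sin (of_real pi * z) \<noteq> 0"
    using assms by (auto simp: sin_eq_0 Ints_def)
  have G0: "Gamma z \<noteq> 0" "Gamma (1 - z) \<noteq> 0"
    using nz by (simp_all add: Gamma_eq_zero_iff)
  have eq: "(\<lambda>z. Gamma z * Gamma (1 - z) * sin (of_real pi * z)) = (\<lambda>z. if z \<in> \<int> then 0 else complex_of_real pi)"
    using Gamma_reflection_complex by (auto simp: fun_eq_iff sin_eq_0 Ints_def field_simps)
  have "((\<lambda>z. Gamma z * Gamma (1 - z) * sin (of_real pi * z)) has_field_derivative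
     (Gamma z * Digamma z * Gamma (1 - z) - Gamma z * (Gamma (1 - z) * Digamma (1 - z))) * sin (of_real pi * z)
      + Gamma z * Gamma (1 - z) * (of_real pi * cos (of_real pi * z))) (at z)"
    using nz by (auto intro!: derivative_eq_intros simp: algebra_simps)
  moreover have "((\<lambda>z. Gamma z * Gamma (1 - z) * sin (of_real pi * z)) has_field_derivative 0) (at z)"
  proof (rule has_field_derivative_transform_within_open[of "\<lambda>_. of_real pi" _ _ "- \<int>"])
    show "open (- \<int> :: complex set)" using closed_Ints by auto
    show "of_real pi = Gamma x * Gamma (1 - x) * sin (of_real pi * x)" if "x \<in> - \<int>" for x :: complex
      using that fun_cong[OF eq, of x] by auto
  qed (use assms in auto)
  ultimately have "(Gamma z * Digamma z * Gamma (1 - z) - Gamma z * (Gamma (1 - z) * Digamma (1 - z))) * sin (of_real pi * z)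
      + Gamma z * Gamma (1 - z) * (of_real pi * cos (of_real pi * z)) = 0"
    by (rule DERIV_unique)
  hence "Gamma z * Gamma (1 - z) * ((Digamma (1 - z) - Digamma z) * sin (of_real pi * z)) =
     Gamma z * Gamma (1 - z) * (of_real pi * cos (of_real pi * z))" by algebra
  hence "(Digamma (1 - z) - Digamma z) * sin (of_real pi * z) = of_real pi * cos (of_real pi * z)"
    using G0 by simp
  thus ?thesis using s0 by (simp add: cot_def eq_divide_eq)
qed

text \<open>Subtracting the series of \<open>Digamma (1 + z)\<close> from that of
  \<open>Digamma (1 - z)\<close> cancels the harmonic terms and the Euler constant. The shift
  \<open>Digamma (1 + z) = Digamma z + 1 / z\<close> then makes the reflection formula applicable
  and accounts for the term \<open>1 / z\<close>.\<close>

lemma cot_partial_fractions: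
  fixes z :: complex
  assumes "z \<notin> \<int>"
  shows "(\<lambda>n. 2 * z / (z\<^sup>2 - of_nat (Suc n) ^ 2)) sums (of_real pi * cot (of_real pi * z) - 1 / z)"
proof -
  have z0: "z \<noteq> 0" "1 - z \<noteq> 0" "1 + z \<noteq> 0"
  proof -
    show "z \<noteq> 0" using assms by auto
    show "1 - z \<noteq> 0" using assms by (metis Ints_1 eq_iff_diff_eq_0)
    show "1 + z \<noteq> 0" using assms by (metis Ints_1 Ints_minus add_eq_0_iff)
  qed
  have D: "(\<lambda>n. inverse (of_nat (Suc n)) - inverse (w + of_nat n)) sums (Digamma w + euler_mascheroni)"
    if "w \<noteq> 0" for w :: complex
    using summable_sums[OF summable_Digamma[OF that]] by (simp add: Digamma_def)
  have "(\<lambda>n. (inverse (of_nat (Suc n)) - inverse (1 - z + of_nat n)) -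
             (inverse (of_nat (Suc n)) - inverse (1 + z + of_nat n))) sums
        ((Digamma (1 - z) + euler_mascheroni) - (Digamma (1 + z) + euler_mascheroni))"
    by (intro sums_diff D z0)
  moreover have "(inverse (of_nat (Suc n)) - inverse (1 - z + of_nat n)) -
             (inverse (of_nat (Suc n)) - inverse (1 + z + of_nat n)) = 2 * z / (z\<^sup>2 - of_nat (Suc n) ^ 2)" for n
  proof -
    have "of_nat (Suc n) \<noteq> z" "of_nat (Suc n) \<noteq> - z"
      using assms by (metis Ints_of_nat, metis Ints_of_nat Ints_minus minus_minus)
    hence "1 - z + of_nat n \<noteq> 0" "1 + z + of_nat n \<noteq> 0"
      by (simp_all add: algebra_simps) (metis add_eq_0_iff minus_add_distrib add.commute add.inverse_inverse add.assoc)
    moreover have "z\<^sup>2 - of_nat (Suc n) ^ 2 = - ((1 - z + of_nat n) * (1 + z + of_nat n))"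
      by (simp add: algebra_simps power2_eq_square)
    ultimately show ?thesis
      by (simp add: divide_simps del: of_nat_Suc) (simp add: algebra_simps)
  qed
  moreover have "Digamma (1 + z) = Digamma z + 1 / z"
    using Digamma_plus1[of z] z0 by (simp add: add.commute)
  ultimately show ?thesis
    using Digamma_reflection_complex[OF assms] by (simp add: algebra_simps del: of_nat_Suc)
qed

section \<open>Partial fractions of the Planck kernel\<close>

lemma cosh_complex_of_real: "cosh (complex_of_real x) = of_real (cosh x)"
  by (simp add: cosh_field_def exp_of_real exp_minus)

lemma sinh_complex_of_real: "sinh (complex_of_real x) = of_real (sinh x)"
  by (simp add: sinh_field_def exp_of_real exp_minus)

text \<open>The cotangent expansion on the imaginary axis: at z = i x / (2 pi) the cotangent of pi z
  is -i coth (x / 2), and coth (x / 2) / 2 = 1 / (exp x - 1) + 1 / 2. Every term and the sum carry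
  the factor -2 pi i, which is cancelled at the end.\<close>

lemma planck_partial_fractions:
  fixes x :: real
  assumes "x > 0"
  shows "(\<lambda>n. 2 * x / (x\<^sup>2 + (2 * pi * real (Suc n))\<^sup>2)) sums (1 / (exp x - 1) - 1 / x + 1 / 2)"
proof -
  define z where "z = \<i> * of_real (x / (2 * pi))"
  have z: "z \<notin> \<int>" using assms by (auto simp: z_def Ints_def complex_eq_iff)
  have piz: "of_real pi * z = \<i> * of_real (x / 2)" by (simp add: z_def)
  have ct: "cot (of_real pi * z) = - \<i> * of_real ((1 + exp (- x)) / (1 - exp (- x)))"
  proof -
    have c: "cos (of_real pi * z) = of_real (cosh (x / 2))"
      unfolding piz using cosh_conv_cos[of "of_real (x / 2)"] by (simp only: cosh_complex_of_real)
    have s: "sin (of_real pi * z) = \<i> * of_real (sinh (x / 2))"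
      unfolding piz using sinh_conv_sin[of "of_real (x / 2)"] by (simp only: sinh_complex_of_real) (simp add: algebra_simps)
    have e: "exp (-x) = exp (-x/2) * exp (-x/2)" by (simp flip: exp_add)
    have e1: "exp (x/2) * exp (-x/2) = 1" by (simp flip: exp_add)
    have "(1 + exp (- x)) * sinh (x / 2) = cosh (x / 2) * (1 - exp (- x))"
      unfolding sinh_field_def cosh_field_def e using e1 by (simp add: field_simps)
    hence "cosh (x / 2) / sinh (x / 2) = (1 + exp (- x)) / (1 - exp (- x))"
      using assms by (simp add: field_simps)
    hence "- \<i> * of_real ((1 + exp (- x)) / (1 - exp (- x))) = - \<i> * of_real (cosh (x / 2) / sinh (x / 2))" by simp
    also have "\<dots> = cot (of_real pi * z)"
    proof -
      have "- \<i> * (c / s) = c / (\<i> * s)" for c s :: complex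
        by (simp add: mult.commute[of \<i>] flip: divide_divide_eq_left)
      thus ?thesis unfolding cot_def c s by simp
    qed
    finally show ?thesis by simp
  qed
  have iz: "1 / z = - 2 * of_real pi * \<i> * of_real (1 / x)"
  proof -
    have "z * (- 2 * of_real pi * \<i> * of_real (1 / x)) = of_real ((x / (2 * pi)) * (2 * pi * (1 / x)))"
      unfolding z_def of_real_mult by simp
    also have "(x / (2 * pi)) * (2 * pi * (1 / x)) = 1" using assms by simp
    finally show ?thesis using assms by (simp add: z_def divide_simps mult.commute)
  qed
  have gen: "P * (- \<i> * of_real q) - (- 2 * P * \<i> * of_real r) = - 2 * P * \<i> * of_real (q / 2 - r)" for P :: complex and q r
    by (simp add: algebra_simps)
  have "of_real pi * cot (of_real pi * z) - 1 / z =
    - 2 * of_real pi * \<i> * of_real ((1 + exp (- x)) / (1 - exp (- x)) / 2 - 1 / x)"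
    unfolding iz ct by (rule gen)
  moreover have "(1 + exp (- x)) / (1 - exp (- x)) / 2 = 1 / (exp x - 1) + 1 / 2"
  proof -
    define E where "E = exp x"
    have E: "E > 1" "exp (- x) = 1 / E" using assms by (simp_all add: E_def exp_minus inverse_eq_divide)
    have "(1 + exp (- x)) / (1 - exp (- x)) / 2 = 1 / (E - 1) + 1 / 2"
      unfolding E(2) using E(1) by (simp add: divide_simps)
    thus ?thesis by (simp add: E_def)
  qed
  ultimately have L: "of_real pi * cot (of_real pi * z) - 1 / z =
    - 2 * of_real pi * \<i> * of_real (1 / (exp x - 1) - 1 / x + 1 / 2)"
    by (simp only: diff_add_eq)
  have T: "2 * z / (z\<^sup>2 - of_nat (Suc n) ^ 2) = - 2 * of_real pi * \<i> * of_real (2 * x / (x\<^sup>2 + (2 * pi * real (Suc n))\<^sup>2))" for n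
  proof -
    have p: "x\<^sup>2 + (2 * pi * real (Suc n))\<^sup>2 > 0" using assms by (intro add_pos_nonneg) auto
    have "z\<^sup>2 - of_nat (Suc n) ^ 2 = - of_real ((x\<^sup>2 + (2 * pi * real (Suc n))\<^sup>2) / (2*pi)^2)"
      by (simp add: z_def power_mult_distrib add_divide_distrib power_divide del: of_nat_Suc)
    hence "2 * z / (z\<^sup>2 - of_nat (Suc n) ^ 2) =
        \<i> * of_real (2 * (x / (2 * pi)) / (- ((x\<^sup>2 + (2 * pi * real (Suc n))\<^sup>2) / (2 * pi) ^ 2)))"
      by (simp only: z_def of_real_mult of_real_divide of_real_minus of_real_numeral) (simp only: times_divide_eq_right mult_ac)
    also have "2 * (x / (2 * pi)) / (- ((x\<^sup>2 + (2 * pi * real (Suc n))\<^sup>2) / (2 * pi) ^ 2)) =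
        (- 2 * pi) * (2 * x / (x\<^sup>2 + (2 * pi * real (Suc n))\<^sup>2))"
      using p by (simp add: power2_eq_square)
    finally show ?thesis by (simp only: of_real_mult of_real_minus of_real_numeral mult_ac)
  qed
  have "(\<lambda>n. - 2 * of_real pi * \<i> * of_real (2 * x / (x\<^sup>2 + (2 * pi * real (Suc n))\<^sup>2))) sums
        (- 2 * of_real pi * \<i> * of_real (1 / (exp x - 1) - 1 / x + 1 / 2))"
    using cot_partial_fractions[OF z] unfolding L T .
  moreover have "- 2 * of_real pi * \<i> \<noteq> 0" by simp
  ultimately have "(\<lambda>n. complex_of_real (2 * x / (x\<^sup>2 + (2 * pi * real (Suc n))\<^sup>2))) sums
        (of_real (1 / (exp x - 1) - 1 / x + 1 / 2))"
    using sums_mult_iff by blast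
  thus ?thesis by (simp only: sums_of_real_iff)
qed

section \<open>Mellin transforms\<close>

lemma borel_measurable_of_real_powr [measurable]:
  "(\<lambda>x. complex_of_real x powr s) \<in> borel_measurable borel"
proof -
  \<comment> \<open>The principal branch made explicit on the real line: \<open>Ln\<close> of a
    negative real has imaginary part pi, and 0 to any power is 0.\<close>
  have eq: "(\<lambda>x. complex_of_real x powr s) =
    (\<lambda>x. if x = 0 then 0 else exp (s * (of_real (ln \<bar>x\<bar>) + (if x < 0 then of_real pi * \<i> else 0))))"
    by (auto simp: fun_eq_iff powr_def Ln_of_real')
  show ?thesis unfolding eq
    by measurable
qed

text \<open>Carries gauge integrability over to the Borel measure. The majorant w is nonnegative on
  S, hence Lebesgue integrable for the completed measure, and Borel measurability of f allows
  leaving the completion.\<close>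

lemma set_integrable_lborel_bound:
  fixes f :: "real \<Rightarrow> 'a :: euclidean_space"
  assumes "f \<in> borel_measurable borel" "S \<in> sets borel" "w integrable_on S"
    and "\<And>x. x \<in> S \<Longrightarrow> norm (f x) \<le> w x"
  shows "set_integrable lborel S f"
proof -
  have [measurable]: "f \<in> borel_measurable borel" "S \<in> sets borel" by fact+
  have M [measurable]: "(\<lambda>x. indicat_real S x *\<^sub>R f x) \<in> borel_measurable lborel" by measurable
  have "w absolutely_integrable_on S"
    using assms(3,4) by (intro nonnegative_absolutely_integrable_1) (auto intro: order_trans[OF norm_ge_zero])
  moreover have "set_borel_measurable lebesgue S f"
    unfolding set_borel_measurable_def
    using M by (rule measurable_completion)
  ultimately have "set_integrable lebesgue S f"
    by (rule set_integrable_bound) (use assms(4) in \<open>auto intro: order_trans[OF _ abs_ge_self]\<close>)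
  thus ?thesis
    unfolding set_integrable_def
    using integrable_completion[OF M] by simp
qed

text \<open>Being a Lebesgue integral, this is 0 wherever the integrand fails to be integrable;
  hence \<open>mellin_diff\<close> asks for integrability of both kernels.\<close>

definition mellin :: "(real \<Rightarrow> real) \<Rightarrow> complex \<Rightarrow> complex" where
  "mellin h s = (LINT x:{0<..}|lborel. of_real (h x) * of_real x powr (s - 1))"

text \<open>
  Expanding \<open>x\<^sup>s\<^sup>-\<^sup>s\<^sup>0\<close> into the exponential series and integrating termwise yields a power series in \<open>s - s0\<close>;
  the partial sums are dominated by \<open>x\<^sup>r + x\<^sup>-\<^sup>r\<close>.
\<close>

lemma mellin_holomorphic_on_ball:
  assumes h: "h \<in> borel_measurable borel"
  assumes int: "\<And>\<sigma>. a < \<sigma> \<Longrightarrow> \<sigma> < b \<Longrightarrow> set_integrable lborel {0<..} (\<lambda>x. h x * x powr (\<sigma> - 1))"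
  assumes s0: "a < Re s0 - r" "Re s0 + r < b"
  shows "mellin h holomorphic_on ball s0 r"
proof (rule power_series_holomorphic)
  fix s assume "s \<in> ball s0 r"
  hence sr: "norm (s - s0) < r" by (simp add: dist_norm norm_minus_commute)
  hence r: "r > 0" using norm_ge_zero[of "s - s0"] by linarith
  define I where "I = (indicator {0<..} :: real \<Rightarrow> real)"
  define u where "u = (\<lambda>x::real. complex_of_real (I x * h x) * of_real x powr (s0 - 1))"
  define c where "c = (\<lambda>n. LBINT x. u x * (of_real (ln x) ^ n / fact n))"
  define w where "w = (\<lambda>x. I x * \<bar>h x\<bar> * x powr (Re s0 + r - 1) + I x * \<bar>h x\<bar> * x powr (Re s0 - r - 1))"
  have [measurable]: "h \<in> borel_measurable borel" "I \<in> borel_measurable borel"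
    using h by (auto simp: I_def)
  have [measurable]: "u \<in> borel_measurable borel" unfolding u_def by measurable
  have wi: "integrable lborel w"
    unfolding w_def
  proof (rule Bochner_Integration.integrable_add)
    have "integrable lborel (\<lambda>x. norm (indicator {0<..} x *\<^sub>R (h x * x powr (\<sigma> - 1))))" if "a < \<sigma>" "\<sigma> < b" for \<sigma>
      using int[OF that] unfolding set_integrable_def by (rule integrable_norm)
    hence *: "integrable lborel (\<lambda>x. I x * \<bar>h x\<bar> * x powr (\<sigma> - 1))" if "a < \<sigma>" "\<sigma> < b" for \<sigma>
      using that by (simp add: abs_mult I_def mult.assoc)
    show "integrable lborel (\<lambda>x. I x * \<bar>h x\<bar> * x powr (Re s0 + r - 1))"
      "integrable lborel (\<lambda>x. I x * \<bar>h x\<bar> * x powr (Re s0 - r - 1))"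
      using *[of "Re s0 + r"] *[of "Re s0 - r"] s0 r by auto
  qed
  have bound: "(\<Sum>n<N. norm (u x * (of_real (ln x) ^ n / fact n) * (s - s0) ^ n)) \<le> w x" for x N
  proof (cases "x > 0")
    case True
    have "(\<Sum>n<N. (norm (s - s0) * \<bar>ln x\<bar>) ^ n / fact n) \<le> exp (norm (s - s0) * \<bar>ln x\<bar>)"
    proof -
      have "(\<Sum>n<N. (norm (s - s0) * \<bar>ln x\<bar>) ^ n /\<^sub>R fact n) \<le> (\<Sum>n. (norm (s - s0) * \<bar>ln x\<bar>) ^ n /\<^sub>R fact n)"
        by (rule sum_le_suminf[OF summable_exp_generic]) auto
      thus ?thesis by (simp add: exp_def field_simps)
    qed
    also have "\<dots> \<le> exp (r * \<bar>ln x\<bar>)" using sr by (intro exp_le_cancel_iff[THEN iffD2] mult_right_mono) auto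
    \<comment> \<open>The exponential equals one of the two powers, according to the sign of
      \<open>ln x\<close>.\<close>
    also have "\<dots> \<le> x powr r + x powr (- r)"
      using True by (cases "ln x \<ge> 0") (auto simp: powr_def)
    finally have *: "(\<Sum>n<N. (norm (s - s0) * \<bar>ln x\<bar>) ^ n / fact n) \<le> x powr r + x powr (- r)" .
    have "(\<Sum>n<N. norm (u x * (of_real (ln x) ^ n / fact n) * (s - s0) ^ n)) =
       \<bar>h x\<bar> * x powr (Re s0 - 1) * (\<Sum>n<N. (norm (s - s0) * \<bar>ln x\<bar>) ^ n / fact n)"
      unfolding sum_distrib_left using True
      by (intro sum.cong refl) (simp add: u_def I_def norm_mult norm_divide norm_power norm_powr_real_powr power_mult_distrib)
    also have "\<dots> \<le> \<bar>h x\<bar> * x powr (Re s0 - 1) * (x powr r + x powr (- r))"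
      by (intro mult_left_mono *) auto
    also have "\<dots> = w x"
      using True by (simp add: w_def I_def powr_add powr_diff powr_minus field_simps)
    finally show ?thesis .
  qed (auto simp: u_def w_def I_def)
  have bound1: "norm (u x * (of_real (ln x) ^ n / fact n) * (s - s0) ^ n) \<le> w x" for x n
    using bound[of x "Suc n"] sum_nonneg[of "{..<n}" "\<lambda>n. norm (u x * (of_real (ln x) ^ n / fact n) * (s - s0) ^ n)"]
    by simp
  have int1: "integrable lborel (\<lambda>x. u x * (of_real (ln x) ^ n / fact n) * (s - s0) ^ n)" for n
  proof (rule Bochner_Integration.integrable_bound[OF wi])
    show "AE x in lborel. norm (u x * (of_real (ln x) ^ n / fact n) * (s - s0) ^ n) \<le> norm (w x)"
      using order_trans[OF bound1 abs_ge_self] by (intro AE_I2) simp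
  qed measurable
  have "(\<lambda>N. LBINT x. (\<Sum>n<N. u x * (of_real (ln x) ^ n / fact n) * (s - s0) ^ n)) \<longlonglongrightarrow>
     (LBINT x. u x * of_real x powr (s - s0))"
  proof (rule integral_dominated_convergence[OF _ _ wi])
    show "AE x in lborel. norm (\<Sum>n<N. u x * (of_real (ln x) ^ n / fact n) * (s - s0) ^ n) \<le> w x" for N
      by (intro AE_I2 order_trans[OF norm_sum bound])
    show "AE x in lborel. (\<lambda>N. \<Sum>n<N. u x * (of_real (ln x) ^ n / fact n) * (s - s0) ^ n)
       \<longlonglongrightarrow> u x * of_real x powr (s - s0)"
    proof (rule AE_I2)
      fix x :: real
      show "(\<lambda>N. \<Sum>n<N. u x * (of_real (ln x) ^ n / fact n) * (s - s0) ^ n) \<longlonglongrightarrow> u x * of_real x powr (s - s0)"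
      proof (cases "x > 0")
        case True
        have "(\<lambda>n. u x * ((of_real (ln x) * (s - s0)) ^ n /\<^sub>R fact n)) sums (u x * exp (of_real (ln x) * (s - s0)))"
          by (intro sums_mult exp_converges)
        also have "exp (of_real (ln x) * (s - s0)) = of_real x powr (s - s0)"
          using True by (simp add: powr_def Ln_of_real mult.commute)
        also have "(\<lambda>n. u x * ((of_real (ln x) * (s - s0)) ^ n /\<^sub>R fact n)) =
            (\<lambda>n. u x * (of_real (ln x) ^ n / fact n) * (s - s0) ^ n)"
          by (simp add: scaleR_conv_of_real power_mult_distrib divide_inverse mult_ac)
        finally show ?thesis by (simp add: sums_def)
      qed (simp add: u_def I_def)
    qed
  qed measurable
  moreover have "(LBINT x. (\<Sum>n<N. u x * (of_real (ln x) ^ n / fact n) * (s - s0) ^ n)) = (\<Sum>n<N. c n * (s - s0) ^ n)" for N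
    unfolding c_def
    by (subst Bochner_Integration.integral_sum[OF int1]) simp
  moreover have "(LBINT x. u x * of_real x powr (s - s0)) = mellin h s"
    unfolding mellin_def set_lebesgue_integral_def
    by (intro Bochner_Integration.integral_cong refl)
       (auto simp: u_def I_def indicator_def mult.assoc simp flip: powr_add)
  ultimately show "(\<lambda>n. c n * (s - s0) ^ n) sums mellin h s" by (simp add: sums_def)
qed

lemma mellin_holomorphic:
  assumes "h \<in> borel_measurable borel"
  assumes "\<And>\<sigma>. a < \<sigma> \<Longrightarrow> set_integrable lborel {0<..} (\<lambda>x. h x * x powr (\<sigma> - 1))"
  shows "mellin h holomorphic_on {s. Re s > a}"
proof -
  \<comment> \<open>Half the distance from s to the boundary line serves as radius; the upper bound
    b only has to lie beyond the disc.\<close>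
  have "\<exists>e>0. mellin h holomorphic_on ball s e" if "Re s > a" for s
    using that mellin_holomorphic_on_ball[OF assms(1), of a "Re s + (Re s - a)" s "(Re s - a) / 2"] assms(2)
    by (intro exI[of _ "(Re s - a) / 2"]) (auto simp: field_simps)
  hence "mellin h analytic_on {s. Re s > a}" by (auto simp: analytic_on_def)
  thus ?thesis by (rule analytic_imp_holomorphic)
qed

section \<open>Rules for Mellin transforms and the elementary kernels\<close>

lemma cmod_of_real_powr: "x > 0 \<Longrightarrow> norm (of_real x powr s :: complex) = x powr Re s" for x :: real
  by (simp add: norm_powr_real_powr)

lemma mellin_integrable:
  assumes "h \<in> borel_measurable borel"
  assumes "set_integrable lborel {0<..} (\<lambda>x. h x * x powr (Re s - 1))"
  shows "set_integrable lborel {0<..} (\<lambda>x. of_real (h x) * complex_of_real x powr (s - 1))"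
proof (rule set_integrable_bound[OF assms(2)])
  have [measurable]: "h \<in> borel_measurable borel" by fact
  show "set_borel_measurable lborel {0<..} (\<lambda>x. of_real (h x) * complex_of_real x powr (s - 1))"
    unfolding set_borel_measurable_def by measurable
qed (auto simp: norm_mult cmod_of_real_powr)

lemma mellin_diff:
  assumes "f \<in> borel_measurable borel" "g \<in> borel_measurable borel"
  assumes "set_integrable lborel {0<..} (\<lambda>x. f x * x powr (Re s - 1))"
  assumes "set_integrable lborel {0<..} (\<lambda>x. g x * x powr (Re s - 1))"
  shows "mellin (\<lambda>x. f x - g x) s = mellin f s - mellin g s"
  unfolding mellin_def using set_integral_diff(2)[OF mellin_integrable[OF assms(1,3)] mellin_integrable[OF assms(2,4)]]
  by (simp add: ring_distribs)

lemma mellin_divide: "mellin (\<lambda>x. h x / c) s = mellin h s / of_real c"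
  unfolding mellin_def by (simp add: set_lebesgue_integral_def)

lemma mellin_divide_arg: "mellin (\<lambda>x. h x / x) s = mellin h (s - 1)"
  unfolding mellin_def
  by (intro set_lebesgue_integral_cong) (auto simp: powr_diff powr_numeral power2_eq_square divide_simps)

lemma mellin_cong: "(\<And>x. x > 0 \<Longrightarrow> f x = g x) \<Longrightarrow> mellin f s = mellin g s"
  unfolding mellin_def by (intro set_lebesgue_integral_cong) auto

lemma mellin_of_real:
  "mellin h (of_real \<sigma>) = of_real (LINT x:{0<..}|lborel. h x * x powr (\<sigma> - 1))"
  unfolding mellin_def set_integral_complex_of_real [symmetric]
  by (intro set_lebesgue_integral_cong) (auto simp: powr_of_real[symmetric])

text \<open>The substitution of a x for x in Euler's integral for \<open>Gamma s\<close>; the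
  Jacobian a raises the exponent s - 1 to s.\<close>

lemma mellin_exp:
  assumes "Re s > 0" "a > 0"
  shows "mellin (\<lambda>x. exp (- (a * x))) s = Gamma s / of_real a powr s"
proof -
  define G where "G = (\<lambda>x. indicat_real {0<..} x *\<^sub>R (of_real (exp (- x)) * complex_of_real x powr (s - 1)))"
  have [measurable]: "G \<in> borel_measurable borel" unfolding G_def by measurable
  have ab: "(\<lambda>x. of_real (exp (- x)) * complex_of_real x powr (s - 1)) absolutely_integrable_on {0<..}"
    using absolutely_integrable_Gamma_integral'[OF assms(1)]
    by (simp add: exp_minus field_simps exp_of_real[symmetric])
  hence "integrable lborel G"
    using integrable_completion[of G lborel] unfolding set_integrable_def G_def[symmetric] by simp
  hence "set_integrable lborel {0<..} (\<lambda>x. of_real (exp (- x)) * complex_of_real x powr (s - 1))"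
    unfolding set_integrable_def G_def .
  from set_borel_integral_eq_integral(2)[OF this]
  have "(LBINT x. G x) = integral {0<..} (\<lambda>x. of_real (exp (- x)) * complex_of_real x powr (s - 1))"
    unfolding set_lebesgue_integral_def G_def .
  also have "\<dots> = Gamma s"
    using Gamma_integral_complex'[OF assms(1)]
    by (intro integral_unique) (simp add: exp_minus field_simps exp_of_real[symmetric])
  finally have "Gamma s = (LBINT x. G x)" ..
  also have "\<dots> = \<bar>a\<bar> *\<^sub>R (LBINT x. G (0 + a * x))"
    using assms by (intro lborel_integral_real_affine) auto
  also have "(LBINT x. G (0 + a * x)) = (LBINT x. of_real a powr (s - 1) *
     (indicat_real {0<..} x *\<^sub>R (of_real (exp (- (a * x))) * complex_of_real x powr (s - 1))))"
    using assms by (intro Bochner_Integration.integral_cong refl)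
      (auto simp: G_def indicator_def zero_less_mult_iff powr_times_real)
  also have "\<dots> = of_real a powr (s - 1) * mellin (\<lambda>x. exp (- (a * x))) s"
    unfolding mellin_def set_lebesgue_integral_def by (rule integral_mult_right_zero)
  also have "\<bar>a\<bar> *\<^sub>R \<dots> = of_real a powr s * mellin (\<lambda>x. exp (- (a * x))) s"
    using assms by (simp add: powr_diff scaleR_conv_of_real)
  finally show ?thesis using assms by simp
qed

text \<open>Absolute convergence of Euler's integral at the real argument \<sigma> + 1. These
  functions dominate the integrands of \<open>planck\<close> and \<open>planck_reg\<close>.\<close>

lemma set_integrable_exp_powr:
  fixes \<sigma> a c :: real
  assumes "\<sigma> > -1" "a > 0"
  shows "set_integrable lborel {0<..} (\<lambda>x. c * exp (- (a * x)) * x powr \<sigma>)"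
proof -
  have "(\<lambda>x. complex_of_real x powr (of_real (\<sigma> + 1) - 1) / of_real (exp (a * x))) absolutely_integrable_on {0<..}"
    using assms by (intro absolutely_integrable_Gamma_integral) auto
  hence "(\<lambda>x. norm (complex_of_real x powr (of_real (\<sigma> + 1) - 1) / of_real (exp (a * x)))) integrable_on {0<..}"
    by (rule absolutely_integrable_on_def[THEN iffD1, THEN conjunct2])
  hence "(\<lambda>x. exp (- (a * x)) * x powr \<sigma>) integrable_on {0<..}"
    by (rule integrable_eq) (auto simp: norm_divide norm_powr_real_powr exp_minus divide_inverse norm_mult norm_inverse)
  hence "(\<lambda>x. \<bar>c\<bar> * (exp (- (a * x)) * x powr \<sigma>)) integrable_on {0<..}"
    by (rule integrable_on_mult_right)
  thus ?thesis
    by (rule set_integrable_lborel_bound[rotated 2]) (auto simp: abs_mult)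
qed

lemma mellin_indicator_lt_1:
  assumes "Re s > 0"
  shows "set_integrable lborel {0<..} (\<lambda>x. (if x < 1 then 1 else 0) * x powr (Re s - 1))"
    and "mellin (\<lambda>x. if x < 1 then 1 else 0) s = 1 / s"
proof -
  let ?h = "\<lambda>x::real. if x < 1 then 1 else 0 :: real"
  have "(\<lambda>x. x powr (Re s - 1)) integrable_on {0<..1}"
    by (rule integrable_on_powr_from_0') (use assms in auto)
  hence "(\<lambda>x. if x \<in> {0<..1} then x powr (Re s - 1) else 0) integrable_on {0<..}"
    by (subst integrable_restrict_Int) (auto simp: greaterThanAtMost_def Int_ac)
  thus int: "set_integrable lborel {0<..} (\<lambda>x. ?h x * x powr (Re s - 1))"
    by (rule set_integrable_lborel_bound[rotated 2]) auto
  have s0: "s \<noteq> 0" using assms by auto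
  \<comment> \<open>The antiderivative is differentiable for t > 0 and, as Re s > 0, continuous up
    to 0, where its value is 0.\<close>
  have "((\<lambda>t. complex_of_real t powr (s - 1)) has_integral
            (of_real 1 powr s / s - of_real 0 powr s / s)) {0..1}"
    using assms s0
    by (intro fundamental_theorem_of_calculus_interior)
       (auto intro!: continuous_intros derivative_eq_intros has_vector_derivative_real_field)
  hence I: "((\<lambda>t. complex_of_real t powr (s - 1)) has_integral (1 / s)) {0..1}" by simp
  \<comment> \<open>The integrand differs from the pure power at most at the endpoints: the cut-off
    excludes 1, the domain excludes 0.\<close>
  have "((\<lambda>x. if x \<in> {0<..1} then of_real (?h x) * complex_of_real x powr (s - 1) else 0) has_integral (1/s)) {0..1}"
    by (rule has_integral_spike_finite[of "{0,1}", OF _ _ I]) auto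
  hence "((\<lambda>x. of_real (?h x) * complex_of_real x powr (s - 1)) has_integral (1/s)) {0<..1}"
    by (subst (asm) has_integral_restrict) auto
  hence "((\<lambda>x. if x \<in> {0<..1} then of_real (?h x) * complex_of_real x powr (s - 1) else 0) has_integral (1/s)) {0<..}"
    by (subst has_integral_restrict) auto
  hence "((\<lambda>x. of_real (?h x) * complex_of_real x powr (s - 1)) has_integral (1/s)) {0<..}"
    by (rule has_integral_eq[rotated]) auto
  moreover have "set_integrable lborel {0<..} (\<lambda>x. of_real (?h x) * complex_of_real x powr (s - 1))"
    by (rule mellin_integrable[OF _ int]) measurable
  ultimately show "mellin ?h s = 1 / s"
    unfolding mellin_def using set_borel_integral_eq_integral(2) integral_unique by metis
qed

text \<open>The part of the constant 1 beyond x = 1 is transformable on the opposite half-plane, and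
  its transform is minus the continuation of the transform 1 / s of the part below 1. Because of
  this sign both regularisations of \<open>planck\<close> produce the same rational terms.\<close>

lemma mellin_indicator_ge_1:
  assumes "\<sigma> < 0"
  shows "set_integrable lborel {0<..} (\<lambda>x. (if x < 1 then 0 else 1) * x powr (\<sigma> - 1))"
    and "mellin (\<lambda>x. if x < 1 then 0 else 1) (of_real \<sigma>) = - 1 / of_real \<sigma>"
proof -
  let ?h = "\<lambda>x::real. if x < 1 then 0 else 1 :: real"
  have "((\<lambda>x. x powr (\<sigma> - 1)) has_integral (- (1 / \<sigma>))) {1..}"
    using has_integral_powr_to_inf[of "\<sigma> - 1" 1] assms by simp
  hence "((\<lambda>x. ?h x * x powr (\<sigma> - 1)) has_integral (- (1 / \<sigma>))) {1..}"
    by (rule has_integral_eq[rotated]) auto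
  hence I: "((\<lambda>x. ?h x * x powr (\<sigma> - 1)) has_integral (- (1 / \<sigma>))) {0<..}"
    by (rule has_integral_on_superset) auto
  thus int: "set_integrable lborel {0<..} (\<lambda>x. ?h x * x powr (\<sigma> - 1))"
    by (intro set_integrable_lborel_bound[OF _ _ has_integral_integrable]) auto
  show "mellin ?h (of_real \<sigma>) = - 1 / of_real \<sigma>"
    unfolding mellin_of_real using set_borel_integral_eq_integral(2)[OF int] integral_unique[OF I] by simp
qed

section \<open>The Mellin transform of the Planck kernel\<close>

text \<open>
  \<open>planck\<close> is the kernel of the classical integral for \<open>\<Gamma>(s) \<zeta>(s)\<close>. Its truncated regularisation
  has a Mellin transform on \<open>Re s > -1\<close>, which continues \<open>\<zeta>\<close>; the full regularisation \<open>planck_osc\<close> is only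
  transformable for \<open>-1 < Re s < 0\<close>, but it has an expansion into partial fractions.
\<close>

definition planck :: "real \<Rightarrow> real" where "planck x = 1 / (exp x - 1)"

definition planck_reg :: "real \<Rightarrow> real" where
  "planck_reg x = planck x - (if x < 1 then 1 / x - 1 / 2 else 0)"

definition planck_osc :: "real \<Rightarrow> real" where "planck_osc x = planck x - 1 / x + 1 / 2"

lemma borel_measurable_planck [measurable]:
  "planck \<in> borel_measurable borel" "planck_reg \<in> borel_measurable borel" "planck_osc \<in> borel_measurable borel"
  unfolding planck_def [abs_def] planck_reg_def [abs_def] planck_osc_def [abs_def] by measurable

lemma planck_bounds:
  assumes "x > 0"
  shows "planck x > 0" "planck x \<le> 2 * exp (- (1 / 2 * x)) / x"
proof -
  have e: "exp x > 1" using assms by simp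
  thus "planck x > 0" by (simp add: planck_def)
  \<comment> \<open>With this E, exp x - 1 = (E - 1) (E + 1), and E - 1 \<ge> x / 2 gives exp x - 1
    \<ge> x E / 2.\<close>
  define E where "E = exp (x / 2)"
  have E: "E \<ge> 1 + x / 2" unfolding E_def by (rule exp_ge_add_one_self)
  have ex: "exp x = E * E" unfolding E_def by (simp flip: exp_add)
  have em: "exp (- (1 / 2 * x)) = 1 / E" by (simp add: E_def exp_minus inverse_eq_divide)
  have "x / 2 * E \<le> (E - 1) * (E + 1)" using E assms by (intro mult_mono) auto
  hence "x * E / 2 \<le> exp x - 1" unfolding ex by (simp add: algebra_simps)
  moreover have "x * E / 2 > 0" using E assms by auto
  ultimately have "planck x \<le> 1 / (x * E / 2)"
    unfolding planck_def using e by (intro divide_left_mono mult_pos_pos) auto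
  also have "\<dots> = 2 * exp (- (1 / 2 * x)) / x" unfolding em by simp
  finally show "planck x \<le> 2 * exp (- (1 / 2 * x)) / x" .
qed

lemma planck_osc_sums:
  "x > 0 \<Longrightarrow> (\<lambda>n. 2 * x / (x\<^sup>2 + (2 * pi * real (Suc n))\<^sup>2)) sums planck_osc x"
  unfolding planck_osc_def planck_def by (rule planck_partial_fractions)

text \<open>All terms of the partial fractions are nonnegative. Dropping \<open>x\<^sup>2\<close>
  from the denominators leaves x / (2 pi^2) times the Basel series, which is x / 12.\<close>

lemma planck_osc_bounds:
  assumes "x > 0"
  shows "0 \<le> planck_osc x" "planck_osc x \<le> x / 12"
proof -
  show "0 \<le> planck_osc x"
    by (rule sums_le[OF _ sums_zero planck_osc_sums[OF assms]]) (use assms in auto)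
  have "(\<lambda>n. x / (2 * pi\<^sup>2) * (1 / (real (Suc n))\<^sup>2)) sums (x / (2 * pi\<^sup>2) * (pi\<^sup>2 / 6))"
    using inverse_squares_sums by (intro sums_mult) (simp add: add.commute)
  hence S: "(\<lambda>n. x / (2 * pi\<^sup>2) * (1 / (real (Suc n))\<^sup>2)) sums (x / 12)" by simp
  show "planck_osc x \<le> x / 12"
  proof (rule sums_le[OF _ planck_osc_sums[OF assms] S])
    fix n
    have "2 * x / (x\<^sup>2 + (2 * pi * real (Suc n))\<^sup>2) \<le> 2 * x / (2 * pi * real (Suc n))\<^sup>2"
      using assms by (intro divide_left_mono mult_pos_pos add_nonneg_pos) auto
    also have "\<dots> = x / (2 * pi\<^sup>2) * (1 / (real (Suc n))\<^sup>2)"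
      by (simp add: power_mult_distrib del: of_nat_Suc)
    finally show "2 * x / (x\<^sup>2 + (2 * pi * real (Suc n))\<^sup>2) \<le> x / (2 * pi\<^sup>2) * (1 / (real (Suc n))\<^sup>2)" .
  qed
qed

text \<open>Below 1 the kernel coincides with \<open>planck_osc\<close>, so the Basel bound applies;
  from 1 on it is \<open>planck\<close>, and 1 / x \<le> x. The common majorant records both the
  zero at 0 and the exponential decay.\<close>

lemma planck_reg_bound:
  assumes "x > 0"
  shows "\<bar>planck_reg x\<bar> \<le> 2 * exp (- (1 / 2 * x)) * x"
proof (cases "x < 1")
  case True
  have "planck_reg x = planck_osc x" using True by (simp add: planck_reg_def planck_osc_def)
  hence "\<bar>planck_reg x\<bar> \<le> x / 12" using planck_osc_bounds[OF assms] by simp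
  \<comment> \<open>For x < 1 the factor 2 (1 - x / 2) exceeds 1, and 1 - x / 2 is at most exp (- x
    / 2).\<close>
  also have "\<dots> \<le> 2 * (1 + - (1 / 2 * x)) * x" using True assms by (simp add: field_simps)
  also have "\<dots> \<le> 2 * exp (- (1 / 2 * x)) * x"
    using assms by (intro mult_right_mono mult_left_mono exp_ge_add_one_self) auto
  finally show ?thesis .
next
  case False
  have "\<bar>planck_reg x\<bar> \<le> 2 * exp (- (1 / 2 * x)) / x"
    using planck_bounds[OF assms] False by (simp add: planck_reg_def)
  also have "\<dots> \<le> 2 * exp (- (1 / 2 * x)) * x"
  proof -
    have "1 / x \<le> x" using False assms by (simp add: divide_le_eq) (smt (verit) mult_le_cancel_left1)
    thus ?thesis using mult_left_mono[of "1/x" x "2 * exp (- (1 / 2 * x))"] by simp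
  qed
  finally show ?thesis .
qed

section \<open>Convergence of the Mellin transforms and the Dirichlet series\<close>

lemma planck_integrable:
  assumes "\<sigma> > 1"
  shows "set_integrable lborel {0<..} (\<lambda>x. planck x * x powr (\<sigma> - 1))"
proof (rule set_integrable_bound)
  show "set_integrable lborel {0<..} (\<lambda>x. 2 * exp (- (1 / 2 * x)) * x powr (\<sigma> - 2))"
    by (rule set_integrable_exp_powr) (use assms in auto)
  show "set_borel_measurable lborel {0<..} (\<lambda>x. planck x * x powr (\<sigma> - 1))"
    unfolding set_borel_measurable_def by measurable
  have "norm (planck x * x powr (\<sigma> - 1)) \<le> norm (2 * exp (- (1 / 2 * x)) * x powr (\<sigma> - 2))" if "x > 0" for x
  proof -
    have "norm (planck x * x powr (\<sigma> - 1)) = planck x * x powr (\<sigma> - 1)"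
      using planck_bounds[OF that] by simp
    also have "\<dots> \<le> 2 * exp (- (1 / 2 * x)) / x * x powr (\<sigma> - 1)"
      by (intro mult_right_mono planck_bounds that) auto
    also have "\<dots> = 2 * exp (- (1 / 2 * x)) * x powr (\<sigma> - 2)"
      using that powr_diff[of x "\<sigma> - 1" 1] by simp
    finally show ?thesis by simp
  qed
  thus "AE x in lborel. x \<in> {0<..} \<longrightarrow> norm (planck x * x powr (\<sigma> - 1)) \<le> norm (2 * exp (- (1 / 2 * x)) * x powr (\<sigma> - 2))"
    by auto
qed

text \<open>Removing 1 / x - 1 / 2 near 0 leaves a kernel of order x, which moves the abscissa of
  convergence from 1 to -1.\<close>

lemma planck_reg_integrable:
  assumes "\<sigma> > -1"
  shows "set_integrable lborel {0<..} (\<lambda>x. planck_reg x * x powr (\<sigma> - 1))"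
proof (rule set_integrable_bound)
  show "set_integrable lborel {0<..} (\<lambda>x. 2 * exp (- (1 / 2 * x)) * x powr \<sigma>)"
    by (rule set_integrable_exp_powr) (use assms in auto)
  show "set_borel_measurable lborel {0<..} (\<lambda>x. planck_reg x * x powr (\<sigma> - 1))"
    unfolding set_borel_measurable_def by measurable
  have "norm (planck_reg x * x powr (\<sigma> - 1)) \<le> norm (2 * exp (- (1 / 2 * x)) * x powr \<sigma>)" if "x > 0" for x
  proof -
    have "norm (planck_reg x * x powr (\<sigma> - 1)) \<le> 2 * exp (- (1 / 2 * x)) * x * x powr (\<sigma> - 1)"
      using mult_right_mono[OF planck_reg_bound[OF that], of "x powr (\<sigma> - 1)"] by (simp add: abs_mult)
    also have "\<dots> = 2 * exp (- (1 / 2 * x)) * x powr \<sigma>"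
      using that by (simp add: powr_diff)
    finally show ?thesis by simp
  qed
  thus "AE x in lborel. x \<in> {0<..} \<longrightarrow> norm (planck_reg x * x powr (\<sigma> - 1)) \<le> norm (2 * exp (- (1 / 2 * x)) * x powr \<sigma>)"
    by auto
qed

lemma mellin_planck_reg_holomorphic: "mellin planck_reg holomorphic_on {s. Re s > -1}"
  by (rule mellin_holomorphic) (auto intro: planck_reg_integrable)

text \<open>The kernel is the geometric series of exp (- n x) over n \<ge> 1, and each term gives a
  rescaled Gamma integral. For termwise integration, positivity of these exponentials bounds every
  partial sum of norms by the norm of the full integrand \<open>U\<close>.\<close>

lemma mellin_planck_sums:
  assumes "Re s > 1"
  shows "(\<lambda>n. Gamma s / of_nat (Suc n) powr s) sums mellin planck s"
proof -
  define u where "u = (\<lambda>n x. indicat_real {0<..} x *\<^sub>R (of_real (exp (- (real (Suc n) * x))) * complex_of_real x powr (s - 1)))"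
  have [measurable]: "u n \<in> borel_measurable borel" for n unfolding u_def by measurable
  have geo: "(\<lambda>n. exp (- (real (Suc n) * x))) sums planck x" if "x > 0" for x
  proof -
    have "(\<lambda>n. exp (- x) * exp (- x) ^ n) sums (exp (- x) * (1 / (1 - exp (- x))))"
      using that by (intro sums_mult geometric_sums) auto
    also have "(\<lambda>n. exp (- x) * exp (- x) ^ n) = (\<lambda>n. exp (- (real (Suc n) * x)))"
      by (simp add: fun_eq_iff algebra_simps flip: exp_of_nat_mult exp_add)
    also have "exp (- x) * (1 / (1 - exp (- x))) = planck x"
    proof -
      define E where "E = exp x"
      have E: "E > 1" "exp (- x) = 1 / E" using that by (simp_all add: E_def exp_minus inverse_eq_divide)
      show ?thesis unfolding planck_def E(2) E_def[symmetric] using E(1) by (simp add: divide_simps)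
    qed
    finally show ?thesis .
  qed
  define U where "U = (\<lambda>x. indicat_real {0<..} x *\<^sub>R (of_real (planck x) * complex_of_real x powr (s - 1)))"
  have [measurable]: "U \<in> borel_measurable borel" unfolding U_def by measurable
  have iU: "integrable lborel (\<lambda>x. norm (U x))"
    using mellin_integrable[OF borel_measurable_planck(1) planck_integrable[OF assms]]
    unfolding set_integrable_def U_def by (rule integrable_norm)
  have us: "(\<lambda>n. u n x) sums U x" for x
  proof (cases "x > 0")
    case True
    have "(\<lambda>n. complex_of_real (exp (- (real (Suc n) * x)))) sums of_real (planck x)"
      using geo[OF True] by (simp only: sums_of_real_iff)
    hence "(\<lambda>n. complex_of_real (exp (- (real (Suc n) * x))) * of_real x powr (s - 1)) sums (of_real (planck x) * of_real x powr (s - 1))"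
      by (rule sums_mult2)
    thus ?thesis using True by (simp add: u_def U_def)
  qed (simp add: u_def U_def)
  have bound: "(\<Sum>n<N. norm (u n x)) \<le> norm (U x)" for N x
  proof (cases "x > 0")
    case True
    have "(\<Sum>n<N. norm (u n x)) = (\<Sum>n<N. exp (- (real (Suc n) * x))) * x powr (Re s - 1)"
      unfolding sum_distrib_right using True
      by (intro sum.cong refl) (simp add: u_def norm_mult cmod_of_real_powr del: of_nat_Suc)
    also have "(\<Sum>n<N. exp (- (real (Suc n) * x))) \<le> planck x"
      using geo[OF True] by (subst sums_unique[OF geo[OF True]], intro sum_le_suminf) (auto simp: sums_iff)
    also have "planck x * x powr (Re s - 1) = norm (U x)"
      using True planck_bounds[OF True] by (simp add: U_def norm_mult cmod_of_real_powr)
    finally show ?thesis by (simp add: mult_right_mono)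
  qed (simp add: u_def)
  have bound1: "norm (u n x) \<le> norm (U x)" for n x
    using bound[of x "Suc n"] sum_nonneg[of "{..<n}" "\<lambda>n. norm (u n x)"] by simp
  have iu: "integrable lborel (u n)" for n
    by (rule Bochner_Integration.integrable_bound[OF iU]) (use bound1 in auto)
  have "(\<lambda>N. LBINT x. (\<Sum>n<N. u n x)) \<longlonglongrightarrow> (LBINT x. U x)"
  proof (rule integral_dominated_convergence[OF _ _ iU])
    show "AE x in lborel. (\<lambda>N. \<Sum>n<N. u n x) \<longlonglongrightarrow> U x" using us by (auto simp: sums_def)
    show "AE x in lborel. norm (\<Sum>n<N. u n x) \<le> norm (U x)" for N
      by (intro AE_I2 order_trans[OF norm_sum bound])
  qed measurable
  moreover have "(LBINT x. (\<Sum>n<N. u n x)) = (\<Sum>n<N. Gamma s / of_nat (Suc n) powr s)" for N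
  proof -
    have "(LBINT x. u n x) = Gamma s / of_nat (Suc n) powr s" for n
      using mellin_exp[of s "real (Suc n)"] assms unfolding u_def mellin_def set_lebesgue_integral_def by simp
    thus ?thesis by (simp add: Bochner_Integration.integral_sum[OF iu])
  qed
  moreover have "(LBINT x. U x) = mellin planck s"
    unfolding U_def mellin_def set_lebesgue_integral_def ..
  ultimately show ?thesis by (simp add: sums_def)
qed

section \<open>Functional equation near the interval (-1, 0)\<close>

text \<open>Up to a power of c, the substitution t = x^2 / (x^2 + c^2) turns the integral into the
  Beta integral with parameters a and 1 - a, where a = (\<sigma> + 1) / 2. By the reflection formula
  this is pi / sin (pi a) = pi / cos (pi \<sigma> / 2).\<close>

lemma integral_rational_powr:
  fixes \<sigma> c :: real
  assumes "-1 < \<sigma>" "\<sigma> < 1" "c > 0"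
  shows "set_integrable lborel {0<..} (\<lambda>x. 2 * x / (x\<^sup>2 + c\<^sup>2) * x powr (\<sigma> - 1))" (is ?A)
    and "(LINT x:{0<..}|lborel. 2 * x / (x\<^sup>2 + c\<^sup>2) * x powr (\<sigma> - 1)) = c powr (\<sigma> - 1) * (pi / cos (pi * \<sigma> / 2))" (is ?B)
proof -
  define a where "a = (\<sigma> + 1) / 2"
  have a: "0 < a" "a < 1" using assms by (auto simp: a_def)
  define f where "f = (\<lambda>t::real. t powr (a - 1) * (1 - t) powr (1 - a - 1))"
  define g where "g = (\<lambda>x::real. x\<^sup>2 / (x\<^sup>2 + c\<^sup>2))"
  define g' where "g' = (\<lambda>x::real. 2 * x * c\<^sup>2 / (x\<^sup>2 + c\<^sup>2)\<^sup>2)"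
  have pos: "x\<^sup>2 + c\<^sup>2 > 0" for x using assms by (intro add_nonneg_pos) auto
  have "(f has_integral Beta a (1 - a)) {0<..<1}"
    using has_integral_Beta_real[of a "1 - a"] a by (simp add: f_def has_integral_Icc_iff_Ioo)
  also have "Beta a (1 - a) = pi / cos (pi * \<sigma> / 2)"
  proof -
    have "complex_of_real (Gamma a * Gamma (1 - a)) = Gamma (of_real a) * Gamma (1 - of_real a)"
      by (simp only: of_real_mult Gamma_complex_of_real[symmetric] of_real_diff of_real_1)
    also have "\<dots> = of_real pi / sin (of_real pi * of_real a)"
      by (rule Gamma_reflection_complex)
    also have "\<dots> = of_real (pi / sin (pi * a))"
      by (simp only: of_real_mult[symmetric] sin_of_real of_real_divide)
    finally have "complex_of_real (Gamma a * Gamma (1 - a)) = of_real (pi / sin (pi * a))" .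
    hence "Gamma a * Gamma (1 - a) = pi / sin (pi * a)" by (simp only: of_real_eq_iff)
    also have "sin (pi * a) = cos (pi * \<sigma> / 2)"
      by (simp add: a_def distrib_left add_divide_distrib sin_add)
    finally show ?thesis by (simp add: Beta_def)
  qed
  finally have I: "(f has_integral (pi / cos (pi * \<sigma> / 2))) {0<..<1}" .
  hence fabs: "f absolutely_integrable_on {0<..<1}"
    by (intro nonnegative_absolutely_integrable_1) (auto simp: f_def)
  have der: "(g has_field_derivative g' x) (at x within {0<..})" for x
    unfolding g_def g'_def using pos[of x]
    by (auto intro!: derivative_eq_intros simp: power2_eq_square algebra_simps)
  have inj: "inj_on g {0<..}"
  proof (rule inj_onI)
    fix x y :: real assume *: "x \<in> {0<..}" "y \<in> {0<..}" "g x = g y"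
    hence "x\<^sup>2 * c\<^sup>2 = y\<^sup>2 * c\<^sup>2" using pos[of x] pos[of y] by (simp add: g_def field_simps)
    thus "x = y" using * assms by simp
  qed
  have img: "g ` {0<..} = {0<..<1}"
  proof (intro equalityI subsetI)
    fix t assume "t \<in> g ` {0<..}"
    thus "t \<in> {0<..<1}" using pos assms by (auto simp: g_def divide_less_eq)
  next
    fix t :: real assume t: "t \<in> {0<..<1}"
    \<comment> \<open>The positive solution of \<open>g x = t\<close>.\<close>
    define x where "x = c * sqrt (t / (1 - t))"
    have x2: "x\<^sup>2 = c\<^sup>2 * t / (1 - t)" using t by (simp add: x_def power_mult_distrib)
    have "x\<^sup>2 + c\<^sup>2 = c\<^sup>2 / (1 - t)" using t unfolding x2 by (simp add: field_simps)
    hence "g x = t" unfolding g_def using t assms by (simp add: x2)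
    moreover have "x > 0" using t assms by (simp add: x_def)
    ultimately show "t \<in> g ` {0<..}" by auto
  qed
  have cv: "(\<lambda>x. \<bar>g' x\<bar> * f (g x)) absolutely_integrable_on {0<..} \<and>
      integral {0<..} (\<lambda>x. \<bar>g' x\<bar> * f (g x)) = pi / cos (pi * \<sigma> / 2)"
    unfolding has_absolute_integral_change_of_variables_1'[OF _ der inj, simplified] img
    using fabs integral_unique[OF I] by blast
  \<comment> \<open>In \<open>f (g x)\<close> the powers of Q = x^2 + c^2 combine to Q, against Q^2
    in the denominator of \<open>g'\<close>; the powers of c multiply to c^(1 - \<sigma>), which the
    prefactor cancels.\<close>
  have eq: "c powr (\<sigma> - 1) * (\<bar>g' x\<bar> * f (g x)) = 2 * x / (x\<^sup>2 + c\<^sup>2) * x powr (\<sigma> - 1)" if x: "x > 0" for x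
  proof -
    define Q where "Q = x\<^sup>2 + c\<^sup>2"
    have Q: "Q > 0" using pos by (simp add: Q_def)
    have "1 - x\<^sup>2 / Q = (Q - x\<^sup>2) / Q" using Q by (simp add: diff_divide_distrib)
    hence "1 - g x = c\<^sup>2 / Q" by (simp add: g_def Q_def)
    have sq: "(y\<^sup>2) powr b = y powr (2 * b)" if "y > 0" for y b :: real
      using powr_powr[of y 2 b] that by simp
    from \<open>1 - g x = _\<close> have "f (g x) = (x\<^sup>2 / Q) powr (a - 1) * (c\<^sup>2 / Q) powr (- a)"
      by (simp add: f_def) (simp add: g_def Q_def)
    also have "\<dots> = (x\<^sup>2) powr (a - 1) * (c\<^sup>2) powr (- a) * (Q powr (1 - a) * Q powr a)"
      using Q x assms by (simp add: powr_divide powr_diff powr_minus field_simps)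
    also have "Q powr (1 - a) * Q powr a = Q" using Q by (simp flip: powr_add)
    also have "(x\<^sup>2) powr (a - 1) = x powr (\<sigma> - 1)"
    proof -
      have "2 * (a - 1) = \<sigma> - 1" by (simp add: a_def field_simps)
      thus ?thesis using sq[OF x, of "a - 1"] by (simp only:)
    qed
    also have "(c\<^sup>2) powr (- a) = c powr (- \<sigma> - 1)"
    proof -
      have "2 * - a = - \<sigma> - 1" by (simp add: a_def field_simps)
      thus ?thesis using sq[OF assms(3), of "- a"] by (simp only:)
    qed
    finally have f: "f (g x) = x powr (\<sigma> - 1) * c powr (- \<sigma> - 1) * Q" .
    have one: "c powr (\<sigma> - 1) * c powr (- \<sigma> - 1) * c\<^sup>2 = 1"
      using assms by (simp flip: powr_numeral powr_add)
    have ab: "\<bar>g' x\<bar> = 2 * x * c\<^sup>2 / Q\<^sup>2" using x by (simp add: g'_def Q_def abs_mult)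
    have "c powr (\<sigma> - 1) * (\<bar>g' x\<bar> * f (g x)) =
        (c powr (\<sigma> - 1) * c powr (- \<sigma> - 1) * c\<^sup>2) * (2 * x / Q * x powr (\<sigma> - 1))"
      unfolding f ab using Q by (simp add: power2_eq_square)
    thus ?thesis unfolding one by (simp add: Q_def)
  qed
  have "((\<lambda>x. c powr (\<sigma> - 1) * (\<bar>g' x\<bar> * f (g x))) has_integral (c powr (\<sigma> - 1) * (pi / cos (pi * \<sigma> / 2)))) {0<..}"
    using cv by (intro has_integral_mult_right) (auto simp: has_integral_iff dest: absolutely_integrable_on_def[THEN iffD1])
  hence H: "((\<lambda>x. 2 * x / (x\<^sup>2 + c\<^sup>2) * x powr (\<sigma> - 1)) has_integral (c powr (\<sigma> - 1) * (pi / cos (pi * \<sigma> / 2)))) {0<..}"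
    by (rule has_integral_eq[rotated]) (use eq in auto)
  show ?A
    by (rule set_integrable_lborel_bound[OF _ _ has_integral_integrable[OF H]]) auto
  from set_borel_integral_eq_integral(2)[OF this] integral_unique[OF H] show ?B by simp
qed

lemma summable_powr_minus:
  fixes \<sigma> :: real
  assumes "\<sigma> < 0"
  shows "summable (\<lambda>n. real (Suc n) powr (\<sigma> - 1))"
  using assms summable_Suc_iff[of "\<lambda>n. real n powr (\<sigma> - 1)"] summable_real_powr_iff[of "\<sigma> - 1"] by simp

text \<open>Termwise integration of the partial fractions. The terms are nonnegative, so the
  integrals of their norms are their own integrals, which are proportional to n^(\<sigma> - 1);
  these powers form the Dirichlet series of zeta at 1 - \<sigma> > 1.\<close>

lemma planck_osc_integral:
  fixes \<sigma> :: real
  assumes "-1 < \<sigma>" "\<sigma> < 0"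
  shows "set_integrable lborel {0<..} (\<lambda>x. planck_osc x * x powr (\<sigma> - 1))"
    and "(LINT x:{0<..}|lborel. planck_osc x * x powr (\<sigma> - 1)) =
         (2 * pi) powr (\<sigma> - 1) * (pi / cos (pi * \<sigma> / 2)) * (\<Sum>n. real (Suc n) powr (\<sigma> - 1))"
proof -
  define u where "u = (\<lambda>n x. indicat_real {0<..} x *\<^sub>R (2 * x / (x\<^sup>2 + (2 * pi * real (Suc n))\<^sup>2) * x powr (\<sigma> - 1)))"
  have us: "(\<lambda>n. u n x) sums (indicator {0<..} x *\<^sub>R (planck_osc x * x powr (\<sigma> - 1)))" for x
  proof (cases "x > 0")
    case True
    thus ?thesis using sums_mult2[OF planck_osc_sums[OF True], of "x powr (\<sigma> - 1)"] by (simp add: u_def)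
  qed (simp add: u_def)
  have un: "norm (u n x) = u n x" for n x by (auto simp: u_def indicator_def)
  define d where "d = (2 * pi) powr (\<sigma> - 1) * (pi / cos (pi * \<sigma> / 2))"
  have ui: "integrable lborel (u n)" "(LBINT x. u n x) = d * real (Suc n) powr (\<sigma> - 1)" for n
    using integral_rational_powr[of \<sigma> "2 * pi * real (Suc n)"] assms
    unfolding u_def set_integrable_def set_lebesgue_integral_def d_def
    by (simp_all add: powr_mult del: of_nat_Suc)
  have sm: "summable (\<lambda>n. LBINT x. norm (u n x))"
    unfolding un ui by (intro summable_mult summable_powr_minus assms)
  have sn: "AE x in lborel. summable (\<lambda>n. norm (u n x))"
    unfolding un using us by (auto simp: sums_iff)
  have eq: "(\<lambda>x. \<Sum>n. u n x) = (\<lambda>x. indicator {0<..} x *\<^sub>R (planck_osc x * x powr (\<sigma> - 1)))"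
    using us by (auto simp: sums_iff)
  show "set_integrable lborel {0<..} (\<lambda>x. planck_osc x * x powr (\<sigma> - 1))"
    using integrable_suminf[OF ui(1) sn sm] unfolding eq set_integrable_def .
  show "(LINT x:{0<..}|lborel. planck_osc x * x powr (\<sigma> - 1)) =
         (2 * pi) powr (\<sigma> - 1) * (pi / cos (pi * \<sigma> / 2)) * (\<Sum>n. real (Suc n) powr (\<sigma> - 1))"
    using integral_suminf[OF ui(1) sn sm] suminf_mult[OF summable_powr_minus[OF assms(2)], of d]
    unfolding eq set_lebesgue_integral_def ui d_def by simp
qed

text \<open>On (0, 1) \<open>planck\<close> and \<open>planck_reg\<close> differ by 1 / x - 1 / 2,
  whose truncated transform converges for Re s > 1 and is elementary.\<close>

lemma mellin_planck_eq:
  assumes "Re s > 1"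
  shows "mellin planck s = mellin planck_reg s + 1 / (s - 1) - 1 / (2 * s)"
proof -
  let ?h = "\<lambda>x::real. if x < 1 then 1 else 0 :: real"
  have i1: "set_integrable lborel {0<..} (\<lambda>x. ?h x / x * x powr (Re s - 1))"
  proof -
    have "set_integrable lborel {0<..} (\<lambda>x. ?h x * x powr (Re (s - 1) - 1))"
      by (rule mellin_indicator_lt_1) (use assms in auto)
    thus ?thesis by (rule set_integrable_cong[THEN iffD1, rotated 3]) (auto simp: powr_diff power2_eq_square)
  qed
  have i2: "set_integrable lborel {0<..} (\<lambda>x. ?h x / 2 * x powr (Re s - 1))"
    using set_integrable_mult_right[of "1/2" lborel "{0<..}" "\<lambda>x. ?h x * x powr (Re s - 1)"]
      mellin_indicator_lt_1(1)[of s] assms by simp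
  have i3: "set_integrable lborel {0<..} (\<lambda>x. (?h x / x - ?h x / 2) * x powr (Re s - 1))"
    using set_integral_diff(1)[OF i1 i2] by (simp add: left_diff_distrib)
  have "mellin planck_reg s = mellin (\<lambda>x. planck x - (?h x / x - ?h x / 2)) s"
    by (rule mellin_cong) (simp add: planck_reg_def)
  also have "\<dots> = mellin planck s - (mellin (\<lambda>x. ?h x / x) s - mellin (\<lambda>x. ?h x / 2) s)"
  proof -
    have "1 < Re s" using assms by simp
    hence "mellin (\<lambda>x. planck x - (?h x / x - ?h x / 2)) s = mellin planck s - mellin (\<lambda>x. ?h x / x - ?h x / 2) s"
      by (intro mellin_diff planck_integrable planck_reg_integrable i3) measurable
    moreover have "mellin (\<lambda>x. ?h x / x - ?h x / 2) s = mellin (\<lambda>x. ?h x / x) s - mellin (\<lambda>x. ?h x / 2) s"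
      by (intro mellin_diff i1 i2) measurable
    ultimately show ?thesis by simp
  qed
  also have "mellin (\<lambda>x. ?h x / x) s = 1 / (s - 1)"
    unfolding mellin_divide_arg using assms by (subst mellin_indicator_lt_1) auto
  also have "mellin (\<lambda>x. ?h x / 2) s = 1 / (2 * s)"
    unfolding mellin_divide using assms by (subst mellin_indicator_lt_1) auto
  finally show ?thesis by simp
qed

text \<open>\<open>planck_osc\<close> arises from \<open>planck_reg\<close> by removing 1 / x - 1 /
  2 for x \<ge> 1 as well. The right-hand side is that of \<open>mellin_planck_eq\<close>, so on
  (-1, 0) the transform of \<open>planck_osc\<close> continues that of
  \<open>planck\<close>.\<close>

lemma mellin_planck_osc_eq:
  fixes \<sigma> :: real
  assumes "-1 < \<sigma>" "\<sigma> < 0"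
  defines "s \<equiv> complex_of_real \<sigma>"
  shows "mellin planck_osc s = mellin planck_reg s + 1 / (s - 1) - 1 / (2 * s)"
proof -
  let ?h = "\<lambda>x::real. if x < 1 then 0 else 1 :: real"
  have i1: "set_integrable lborel {0<..} (\<lambda>x. ?h x / x * x powr (Re s - 1))"
  proof -
    have "set_integrable lborel {0<..} (\<lambda>x. ?h x * x powr ((\<sigma> - 1) - 1))"
      by (rule mellin_indicator_ge_1) (use assms in auto)
    thus ?thesis by (rule set_integrable_cong[THEN iffD1, rotated 3]) (auto simp: powr_diff power2_eq_square s_def)
  qed
  have i2: "set_integrable lborel {0<..} (\<lambda>x. ?h x / 2 * x powr (Re s - 1))"
    using set_integrable_mult_right[of "1/2" lborel "{0<..}" "\<lambda>x. ?h x * x powr (Re s - 1)"]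
      mellin_indicator_ge_1(1)[of \<sigma>] assms by simp
  have i3: "set_integrable lborel {0<..} (\<lambda>x. (?h x / x - ?h x / 2) * x powr (Re s - 1))"
    using set_integral_diff(1)[OF i1 i2] by (simp add: left_diff_distrib)
  have "mellin planck_osc s = mellin (\<lambda>x. planck_reg x - (?h x / x - ?h x / 2)) s"
    by (rule mellin_cong) (simp add: planck_reg_def planck_osc_def)
  also have "\<dots> = mellin planck_reg s - (mellin (\<lambda>x. ?h x / x) s - mellin (\<lambda>x. ?h x / 2) s)"
  proof -
    have "-1 < Re s" using assms by simp
    hence "mellin (\<lambda>x. planck_reg x - (?h x / x - ?h x / 2)) s = mellin planck_reg s - mellin (\<lambda>x. ?h x / x - ?h x / 2) s"
      by (intro mellin_diff planck_integrable planck_reg_integrable i3) measurable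
    moreover have "mellin (\<lambda>x. ?h x / x - ?h x / 2) s = mellin (\<lambda>x. ?h x / x) s - mellin (\<lambda>x. ?h x / 2) s"
      by (intro mellin_diff i1 i2) measurable
    ultimately show ?thesis by simp
  qed
  also have "mellin (\<lambda>x. ?h x / x) s = - 1 / (s - 1)"
    unfolding mellin_divide_arg s_def using assms mellin_indicator_ge_1(2)[of "\<sigma> - 1"] by simp
  also have "mellin (\<lambda>x. ?h x / 2) s = - 1 / (2 * s)"
    unfolding mellin_divide s_def using assms by (subst mellin_indicator_ge_1) auto
  finally show ?thesis by simp
qed

text \<open>For Re s > 1 this is the transform of \<open>planck\<close> divided by \<Gamma>(s). The
  term -1 / (2 s) has been merged with \<open>rGamma s = s * rGamma (s + 1)\<close>, which leaves no
  singularity at s = 0.\<close>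

definition zeta_right :: "complex \<Rightarrow> complex" where
  "zeta_right s = rGamma s * (mellin planck_reg s + 1 / (s - 1)) - rGamma (s + 1) / 2"

lemma zeta_right_eq:
  assumes "s \<noteq> 0"
  shows "zeta_right s = rGamma s * (mellin planck_reg s + 1 / (s - 1) - 1 / (2 * s))"
  using rGamma_plus1[of s, symmetric] assms by (simp add: zeta_right_def algebra_simps)

lemma zeta_right_sums:
  assumes "Re s > 1"
  shows "(\<lambda>n. 1 / of_nat (Suc n) powr s) sums zeta_right s"
proof -
  have s: "s \<noteq> 0" "s \<notin> \<int>\<^sub>\<le>\<^sub>0" using assms by (auto elim!: nonpos_Ints_cases)
  have "(\<lambda>n. rGamma s * (Gamma s / of_nat (Suc n) powr s)) sums (rGamma s * mellin planck s)"
    by (intro sums_mult mellin_planck_sums assms)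
  moreover have "rGamma s * Gamma s = 1"
    using s by (simp add: Gamma_def rGamma_eq_zero_iff)
  ultimately have "(\<lambda>n. 1 / of_nat (Suc n) powr s) sums (rGamma s * mellin planck s)"
    by (simp only: times_divide_eq_right)
  thus ?thesis
    using mellin_planck_eq[OF assms] zeta_right_eq[OF s(1)] by simp
qed

lemma zeta_right_holomorphic: "zeta_right holomorphic_on {s. Re s > -1} - {1}"
  unfolding zeta_right_def [abs_def]
  by (intro holomorphic_intros holomorphic_on_subset[OF mellin_planck_reg_holomorphic]) auto

definition zeta_factor :: "complex \<Rightarrow> complex" where
  "zeta_factor s = 2 * of_real (2 * pi) powr (s - 1) * sin (of_real pi * s / 2) * Gamma (1 - s)"

text \<open>On (-1, 0) \<open>zeta_right\<close> is the transform of \<open>planck_osc\<close> over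
  \<Gamma>(s), and the termwise integral already contains the Dirichlet series at 1 - s. Reflection
  and the double angle formula turn 1 / \<Gamma>(s) into 2 sin (pi s / 2) cos (pi s / 2) \<Gamma>(1
  - s) / pi, whose cosine cancels that of the Beta integral.\<close>

lemma zeta_right_functional_equation_real:
  fixes \<sigma> :: real
  assumes "-1 < \<sigma>" "\<sigma> < 0"
  defines "s \<equiv> complex_of_real \<sigma>"
  shows "zeta_right s = zeta_factor s * zeta_right (1 - s)"
proof -
  have s: "s \<noteq> 0" "1 - s \<notin> \<int>\<^sub>\<le>\<^sub>0" using assms by (auto elim!: nonpos_Ints_cases simp: complex_eq_iff)
  have "- pi < pi * \<sigma>" using mult_strict_left_mono[of "-1" \<sigma> pi] assms by simp
  moreover have "pi * \<sigma> < 0" using assms by (simp add: mult_pos_neg)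
  ultimately have cpos: "cos (pi * \<sigma> / 2) > 0" using assms by (intro cos_gt_zero_pi) auto
  have "(\<lambda>n. complex_of_real (real (Suc n) powr (\<sigma> - 1))) sums zeta_right (1 - s)"
  proof -
    have "1 / of_nat (Suc n) powr (1 - s) = complex_of_real (real (Suc n) powr (\<sigma> - 1))" for n
    proof -
      have "1 / of_nat (Suc n) powr (1 - s) = complex_of_real (real (Suc n)) powr of_real (\<sigma> - 1)"
        by (simp add: s_def powr_minus[symmetric] inverse_eq_divide[symmetric] del: of_nat_Suc)
      thus ?thesis by (subst (asm) powr_of_real) auto
    qed
    thus ?thesis using zeta_right_sums[of "1 - s"] assms by (simp add: s_def)
  qed
  moreover have "(\<lambda>n. complex_of_real (real (Suc n) powr (\<sigma> - 1))) sums of_real (\<Sum>n. real (Suc n) powr (\<sigma> - 1))"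
    by (intro sums_of_real summable_sums summable_powr_minus assms)
  ultimately have Z: "zeta_right (1 - s) = of_real (\<Sum>n. real (Suc n) powr (\<sigma> - 1))"
    by (rule sums_unique2)
  have "zeta_right s = rGamma s * mellin planck_osc s"
    using zeta_right_eq[OF s(1)] mellin_planck_osc_eq[OF assms(1,2)] by (simp add: s_def)
  also have "mellin planck_osc s = of_real ((2 * pi) powr (\<sigma> - 1)) * (of_real pi / of_real (cos (pi * \<sigma> / 2))) * zeta_right (1 - s)"
    unfolding Z unfolding s_def mellin_of_real planck_osc_integral(2)[OF assms(1,2)] by simp
  also have "of_real ((2 * pi) powr (\<sigma> - 1)) = complex_of_real (2 * pi) powr (s - 1)"
    using powr_of_real[of "2 * pi" "\<sigma> - 1"] by (simp add: s_def)
  also have c: "complex_of_real (cos (pi * \<sigma> / 2)) = cos (of_real pi * s / 2)"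
    by (simp add: s_def flip: cos_of_real)
  also have "rGamma s = 2 * sin (of_real pi * s / 2) * cos (of_real pi * s / 2) * Gamma (1 - s) / of_real pi"
  proof -
    have "rGamma s * rGamma (1 - s) * Gamma (1 - s) = sin (2 * (of_real pi * s / 2)) / of_real pi * Gamma (1 - s)"
      unfolding rGamma_reflection_complex by simp
    moreover have "rGamma (1 - s) * Gamma (1 - s) = 1" using s by (simp add: Gamma_def rGamma_eq_zero_iff)
    ultimately show ?thesis unfolding sin_double by (simp add: mult.assoc)
  qed
  finally have *: "zeta_right s = 2 * sin (of_real pi * s / 2) * cos (of_real pi * s / 2) * Gamma (1 - s) / of_real pi *
      (complex_of_real (2 * pi) powr (s - 1) * (of_real pi / cos (of_real pi * s / 2)) * zeta_right (1 - s))" .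
  show ?thesis
  proof -
    have "cos (of_real pi * s / 2) \<noteq> 0" using cpos unfolding c[symmetric] by simp
    thus ?thesis unfolding * by (simp add: zeta_factor_def)
  qed
qed

section \<open>Analytic continuation of the zeta function\<close>

lemma zeta_factor_holomorphic: "zeta_factor holomorphic_on {s. Re s < 1}"
proof -
  have "1 - s \<notin> \<int>\<^sub>\<le>\<^sub>0" if "Re s < 1" for s :: complex
    using that by (auto elim!: nonpos_Ints_cases simp: complex_eq_iff)
  thus ?thesis unfolding zeta_factor_def [abs_def]
    by (auto intro!: holomorphic_intros)
qed

lemma zeta_right_reflect_holomorphic:
  "(\<lambda>s. zeta_factor s * zeta_right (1 - s)) holomorphic_on {s. Re s < 1} - {0}"
  by (intro holomorphic_on_mult holomorphic_on_subset[OF zeta_factor_holomorphic]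
      holomorphic_on_compose_gen[OF _ zeta_right_holomorphic, of "\<lambda>s. 1 - s", unfolded o_def])
     (auto intro!: holomorphic_intros)

text \<open>Identity theorem on the strip without 0, where 1 - s would meet the pole at 1: the
  difference of the two sides vanishes on the real interval (-1, 0).\<close>

lemma zeta_right_functional_equation:
  assumes "-1 < Re s" "Re s < 1" "s \<noteq> 0"
  shows "zeta_right s = zeta_factor s * zeta_right (1 - s)"
proof -
  define S where "S = {s. -1 < Re s} \<inter> {s. Re s < 1} - {0}"
  define U where "U = complex_of_real ` {-1<..<0}"
  have "zeta_right s - zeta_factor s * zeta_right (1 - s) = 0"
  proof (rule analytic_continuation[of "\<lambda>s. zeta_right s - zeta_factor s * zeta_right (1 - s)" S U "of_real (- 1 / 2)"])
    show "(\<lambda>s. zeta_right s - zeta_factor s * zeta_right (1 - s)) holomorphic_on S"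
      by (intro holomorphic_on_diff holomorphic_on_subset[OF zeta_right_holomorphic]
          holomorphic_on_subset[OF zeta_right_reflect_holomorphic]) (auto simp: S_def)
    show "open S" unfolding S_def
      by (intro open_Diff open_Int open_halfspace_Re_gt open_halfspace_Re_lt) auto
    show "connected S" unfolding S_def
      by (intro connected_open_delete open_Int open_halfspace_Re_gt open_halfspace_Re_lt
          convex_connected convex_Int convex_halfspace_Re_gt convex_halfspace_Re_lt) auto
    show "U \<subseteq> S" by (auto simp: U_def S_def)
    show "complex_of_real (- 1 / 2) \<in> S" by (auto simp: S_def complex_eq_iff)
    show "complex_of_real (- 1 / 2) islimpt U"
      unfolding islimpt_approachable
    proof (intro allI impI)
      fix e :: real assume e: "e > 0"
      \<comment> \<open>A point of the interval close to -1 / 2 but distinct from it; the cap 1 / 4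
        keeps it below 0.\<close>
      define t where "t = - 1 / 2 + min (e / 2) (1 / 4)"
      have t: "t \<in> {-1<..<0}" "t \<noteq> - 1 / 2" "\<bar>t - (- 1 / 2)\<bar> < e" using e by (auto simp: t_def)
      have "dist (complex_of_real t) (of_real (- 1 / 2)) < e"
        unfolding dist_of_real using t(3) by (simp add: dist_real_def)
      thus "\<exists>x'\<in>U. x' \<noteq> complex_of_real (- 1 / 2) \<and> dist x' (complex_of_real (- 1 / 2)) < e"
        using t(1,2) unfolding U_def by (intro bexI[of _ "of_real t"]) (auto simp only: of_real_eq_iff image_eqI)
    qed
    show "zeta_right z - zeta_factor z * zeta_right (1 - z) = 0" if "z \<in> U" for z
      using that zeta_right_functional_equation_real by (auto simp: U_def)
    show "s \<in> S" using assms by (auto simp: S_def)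
  qed
  thus ?thesis by simp
qed

text \<open>The punctured plane is connected, so the identity theorem applies. This yields both the
  uniqueness in the definition of \<open>riemann_zeta\<close> and its conjugation symmetry.\<close>

lemma dirichlet_continuation_unique:
  assumes "f holomorphic_on - {1}" "g holomorphic_on - {1}"
    and "\<And>s. Re s > 1 \<Longrightarrow> f s = g s" "s \<noteq> 1"
  shows "f s = g s"
proof (rule analytic_continuation_open[of "{s. Re s > 1}" "- {1}" f g])
  show "{s. 1 < Re s} \<noteq> {}" by (auto intro: exI[of _ 2])
  show "connected (- {1 :: complex})"
    using connected_open_delete[of "UNIV :: complex set" 1]
    by (simp add: Compl_eq_Diff_UNIV connected_UNIV)
qed (use assms in \<open>auto simp: open_halfspace_Re_gt\<close>)

text \<open>The value at the pole is the one prescribed for \<open>riemann_zeta\<close>; for Re s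
  \<le> -1 the functional equation serves as the definition.\<close>

definition zeta_glued :: "complex \<Rightarrow> complex" where
  "zeta_glued s = (if s = 1 then 0 else if Re s > -1 then zeta_right s else zeta_factor s * zeta_right (1 - s))"

lemma zeta_glued_eq: "s \<noteq> 1 \<Longrightarrow> Re s > -1 \<Longrightarrow> zeta_glued s = zeta_right s"
  by (simp add: zeta_glued_def)

lemma zeta_glued_sums:
  assumes "Re s > 1"
  shows "(\<lambda>n. 1 / of_nat (Suc n) powr s) sums zeta_glued s"
proof -
  have "s \<noteq> 1" "Re s > -1" using assms by auto
  thus ?thesis using zeta_right_sums[OF assms] by (subst zeta_glued_eq)
qed

text \<open>The half-planes Re s > -1 and Re s < 0 cover the plane and overlap in a strip, on which
  the functional equation identifies the two branches.\<close>

lemma zeta_glued_holomorphic: "zeta_glued holomorphic_on - {1}"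
proof -
  have "zeta_glued holomorphic_on {s. Re s > -1} - {1}"
    using zeta_right_holomorphic by (rule holomorphic_transform) (auto simp: zeta_glued_def)
  moreover have "zeta_glued holomorphic_on {s. Re s < 0}"
  proof (rule holomorphic_transform[OF holomorphic_on_subset[OF zeta_right_reflect_holomorphic]])
    show "zeta_factor s * zeta_right (1 - s) = zeta_glued s" if "s \<in> {s. Re s < 0}" for s
    proof -
      have "s \<noteq> 0" "s \<noteq> 1" using that by auto
      thus ?thesis using that zeta_right_functional_equation[of s] by (auto simp: zeta_glued_def)
    qed
  qed auto
  ultimately have "zeta_glued holomorphic_on ({s. Re s > -1} - {1}) \<union> {s. Re s < 0}"
    by (intro holomorphic_on_Un open_Diff open_halfspace_Re_gt open_halfspace_Re_lt) auto
  thus ?thesis by (rule holomorphic_on_subset) auto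
qed

text \<open>In the definite description, \<open>zeta_glued\<close> witnesses existence, and the
  identity theorem gives uniqueness.\<close>

lemma riemann_zeta_eq_glued: "riemann_zeta = zeta_glued"
  unfolding riemann_zeta_def
proof (rule the_equality, intro conjI allI impI)
  show "zeta_glued holomorphic_on - {1}" by (rule zeta_glued_holomorphic)
  show "(\<lambda>n. 1 / of_nat (Suc n) powr s) sums zeta_glued s" if "Re s > 1" for s
    using that by (rule zeta_glued_sums)
  show "zeta_glued 1 = 0" by (simp add: zeta_glued_def)
next
  fix f :: "complex \<Rightarrow> complex"
  assume f: "f holomorphic_on - {1} \<and> (\<forall>s. Re s > 1 \<longrightarrow> (\<lambda>n. 1 / of_nat (Suc n) powr s) sums f s) \<and> f 1 = 0"
  show "f = zeta_glued"
  proof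
    fix s
    show "f s = zeta_glued s"
    proof (cases "s = 1")
      case False
      have "f s = zeta_glued s" if "Re s > 1" for s
      proof -
        have "(\<lambda>n. 1 / of_nat (Suc n) powr s) sums f s" using f that by blast
        thus ?thesis using zeta_glued_sums[OF that] by (rule sums_unique2)
      qed
      thus ?thesis
        by (rule dirichlet_continuation_unique[OF conjunct1[OF f] zeta_glued_holomorphic _ False])
    next
      case True
      moreover have "f 1 = 0" using f by blast
      ultimately show ?thesis by (simp add: zeta_glued_def)
    qed
  qed
qed

section \<open>Functional equation, conjugation symmetry and logarithmic derivative of the
  factor\<close>

lemma riemann_zeta_holomorphic: "riemann_zeta holomorphic_on - {1}"
  unfolding riemann_zeta_eq_glued by (rule zeta_glued_holomorphic)

lemma riemann_zeta_sums:
  "Re s > 1 \<Longrightarrow> (\<lambda>n. 1 / of_nat (Suc n) powr s) sums riemann_zeta s"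
  unfolding riemann_zeta_eq_glued by (rule zeta_glued_sums)

lemma riemann_zeta_functional_equation:
  assumes "0 < Re s" "Re s < 1"
  shows "riemann_zeta s = zeta_factor s * riemann_zeta (1 - s)"
proof -
  have "s \<noteq> 0" "s \<noteq> 1" "1 - s \<noteq> 1" using assms by auto
  thus ?thesis
    using zeta_right_functional_equation[of s] zeta_glued_eq[of s] zeta_glued_eq[of "1 - s"] assms
    by (simp add: riemann_zeta_eq_glued)
qed

text \<open>Schwarz reflection: \<open>cnj \<circ> riemann_zeta \<circ> cnj\<close> is holomorphic
  off 1 and has the same Dirichlet series, whose coefficients are real.\<close>

lemma riemann_zeta_cnj:
  assumes "s \<noteq> 1"
  shows "riemann_zeta (cnj s) = cnj (riemann_zeta s)"
proof -
  have "(cnj \<circ> riemann_zeta \<circ> cnj) s = riemann_zeta s"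
  proof (rule dirichlet_continuation_unique[where f = "cnj \<circ> riemann_zeta \<circ> cnj" and g = riemann_zeta and s = s])
    have "cnj ` (- {1}) \<subseteq> - {1}" by auto
    hence "riemann_zeta holomorphic_on cnj ` (- {1})"
      by (rule holomorphic_on_subset[OF riemann_zeta_holomorphic])
    thus "cnj \<circ> riemann_zeta \<circ> cnj holomorphic_on - {1}"
      by (rule holomorphic_on_compose_cnj_cnj) auto
    fix s :: complex assume s: "Re s > 1"
    hence "(\<lambda>n. cnj (1 / of_nat (Suc n) powr cnj s)) sums cnj (riemann_zeta (cnj s))"
      unfolding sums_cnj by (intro riemann_zeta_sums) auto
    also have "(\<lambda>n. cnj (1 / of_nat (Suc n) powr cnj s)) = (\<lambda>n. 1 / of_nat (Suc n) powr s)"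
      by (simp add: fun_eq_iff cnj_powr del: of_nat_Suc)
    finally show "(cnj \<circ> riemann_zeta \<circ> cnj) s = riemann_zeta s"
      using riemann_zeta_sums[OF s] by (auto dest: sums_unique2)
  qed (use assms riemann_zeta_holomorphic in auto)
  thus ?thesis by (metis comp_apply complex_cnj_cnj)
qed

lemma deriv_riemann_zeta_cnj:
  assumes "s \<noteq> 1"
  shows "deriv riemann_zeta (cnj s) = cnj (deriv riemann_zeta s)"
proof -
  have "(riemann_zeta has_field_derivative deriv riemann_zeta s) (at s)"
    by (rule holomorphic_derivI[OF riemann_zeta_holomorphic]) (use assms in auto)
  hence "((cnj \<circ> riemann_zeta \<circ> cnj) has_field_derivative cnj (deriv riemann_zeta s)) (at (cnj s))"
    by (intro has_field_derivative_cnj_cnj) auto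
  hence "(riemann_zeta has_field_derivative cnj (deriv riemann_zeta s)) (at (cnj s))"
    by (rule has_field_derivative_transform_within_open[of _ _ _ "- {1}"])
       (use assms riemann_zeta_cnj in \<open>auto simp: complex_eq_iff\<close>)
  thus ?thesis by (rule DERIV_imp_deriv)
qed

lemma Digamma_cnj:
  assumes "z \<noteq> 0"
  shows "Digamma (cnj z) = cnj (Digamma z)"
proof -
  have "(\<lambda>n. inverse (of_nat (Suc n)) - inverse (z + of_nat n)) sums (Digamma z + euler_mascheroni)"
    using summable_sums[OF summable_Digamma[OF assms]] by (simp only: Digamma_def diff_add_cancel)
  hence "(\<lambda>n. cnj (inverse (of_nat (Suc n)) - inverse (z + of_nat n))) sums cnj (Digamma z + euler_mascheroni)"
    unfolding sums_cnj .
  hence "(\<lambda>n. inverse (of_nat (Suc n)) - inverse (cnj z + of_nat n)) sums (cnj (Digamma z) + cnj euler_mascheroni)"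
    by simp
  moreover have "cnj euler_mascheroni = euler_mascheroni"
    using complex_cnj_complex_of_real[of euler_mascheroni] by (simp only: of_real_euler_mascheroni)
  ultimately have "Digamma (cnj z) + euler_mascheroni = cnj (Digamma z) + euler_mascheroni"
    using summable_sums[OF summable_Digamma[of "cnj z"]] assms
    by (simp only: Digamma_def diff_add_cancel) (simp add: sums_iff del: of_nat_Suc)
  thus ?thesis by simp
qed

text \<open>The three summands are the logarithmic derivatives of the power, the sine and the Gamma
  factor, none of which has a zero or a pole in the critical strip.\<close>

lemma zeta_factor_has_field_derivative:
  assumes "0 < Re s" "Re s < 1"
  shows "(zeta_factor has_field_derivative zeta_factor s *
     (of_real (ln (2 * pi)) + of_real pi / 2 * cot (of_real pi * s / 2) - Digamma (1 - s))) (at s)"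
proof -
  have G: "1 - s \<notin> \<int>\<^sub>\<le>\<^sub>0" using assms by (auto elim!: nonpos_Ints_cases simp: complex_eq_iff)
  have sn: "sin (of_real pi * s / 2) \<noteq> 0"
  proof
    assume "sin (of_real pi * s / 2) = 0"
    \<comment> \<open>A zero of the sine makes s an even integer, but the open critical strip
      contains no integer.\<close>
    then obtain n :: int where "of_real pi * s / 2 = of_real (of_int n) * of_real pi"
      unfolding sin_eq_0 by (auto simp: mult_ac)
    hence "s = of_int (2 * n)" by (simp add: field_simps)
    hence "Re s = of_int (2 * n)" by simp
    with assms have "(0 :: real) < of_int (2 * n)" "of_int (2 * n) < (1 :: real)" by simp_all
    hence "0 < 2 * n" "2 * n < 1" by (simp_all only: of_int_0_less_iff of_int_less_1_iff)
    thus False by presburger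
  qed
  have p: "of_real (2 * pi) \<noteq> (0 :: complex)" by simp
  have Ln: "Ln (of_real (2 * pi)) = of_real (ln (2 * pi))" by (rule Ln_of_real) simp
  have "((\<lambda>s. of_real (2 * pi) powr (s - 1)) has_field_derivative
      of_real (ln (2 * pi)) * of_real (2 * pi) powr (s - 1) * (1 - 0)) (at s)"
    by (rule DERIV_chain2[OF has_field_derivative_powr_right[OF p, unfolded Ln]]) (intro derivative_intros)
  hence "((\<lambda>s. of_real (2 * pi) powr (s - 1)) has_field_derivative
      of_real (2 * pi) powr (s - 1) * of_real (ln (2 * pi))) (at s)"
    by (simp only: diff_0_right mult_1_right mult_1_left mult_ac)
  moreover have "((\<lambda>s. sin (of_real pi * s / 2)) has_field_derivative
      sin (of_real pi * s / 2) * (of_real pi / 2 * cot (of_real pi * s / 2))) (at s)"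
    using sn by (auto intro!: derivative_eq_intros simp: cot_def)
  moreover have "((\<lambda>s. Gamma (1 - s)) has_field_derivative Gamma (1 - s) * (- Digamma (1 - s))) (at s)"
    using G by (auto intro!: derivative_eq_intros)
  ultimately have "((\<lambda>s. of_real (2 * pi) powr (s - 1) * sin (of_real pi * s / 2) * Gamma (1 - s)) has_field_derivative
     (of_real (2 * pi) powr (s - 1) * of_real (ln (2 * pi)) * sin (of_real pi * s / 2) +
      sin (of_real pi * s / 2) * (of_real pi / 2 * cot (of_real pi * s / 2)) * of_real (2 * pi) powr (s - 1)) * Gamma (1 - s) +
     Gamma (1 - s) * (- Digamma (1 - s)) * (of_real (2 * pi) powr (s - 1) * sin (of_real pi * s / 2))) (at s)"
    by (intro DERIV_mult)
  from DERIV_cmult[OF this, of 2] have D: "(zeta_factor has_field_derivative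
     2 * ((of_real (2 * pi) powr (s - 1) * of_real (ln (2 * pi)) * sin (of_real pi * s / 2) +
      sin (of_real pi * s / 2) * (of_real pi / 2 * cot (of_real pi * s / 2)) * of_real (2 * pi) powr (s - 1)) * Gamma (1 - s) +
     Gamma (1 - s) * (- Digamma (1 - s)) * (of_real (2 * pi) powr (s - 1) * sin (of_real pi * s / 2)))) (at s)"
    unfolding zeta_factor_def [abs_def] mult.assoc .
  have "2 * ((P * L * S + S * K * P) * G + G * - D * (P * S)) = 2 * P * S * G * (L + K - D)"
    for P L S K G D :: complex by algebra
  thus ?thesis unfolding zeta_factor_def [of s] by (rule DERIV_cong[OF D])
qed

section \<open>The critical line\<close>

lemma one_minus_crit: "1 - crit \<rho> = cnj (crit \<rho>)"
  by (simp add: crit_def complex_eq_iff)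

lemma crit_not_Ints: "crit \<rho> \<notin> \<int>"
proof
  assume "crit \<rho> \<in> \<int>"
  then obtain n where "crit \<rho> = of_int n" by (auto elim: Ints_cases)
  hence "Re (crit \<rho>) = of_int n" by simp
  hence "of_int (2 * n) = (of_int 1 :: real)" by (simp add: crit_def)
  hence "2 * n = 1" by (simp only: of_int_eq_iff)
  thus False by presburger
qed

lemma sin_pi_crit: "sin (of_real pi * crit \<rho>) = of_real (cosh (pi * \<rho>))"
  and cos_pi_crit: "cos (of_real pi * crit \<rho>) = - \<i> * of_real (sinh (pi * \<rho>))"
proof -
  have e: "of_real pi * crit \<rho> = of_real (pi / 2) + \<i> * of_real (pi * \<rho>)"
    by (simp add: crit_def complex_eq_iff)
  have c: "cos (\<i> * of_real (pi * \<rho>)) = of_real (cosh (pi * \<rho>))"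
    using cosh_conv_cos[of "of_real (pi * \<rho>)"] by (simp only: cosh_complex_of_real)
  have s: "- \<i> * sin (\<i> * of_real (pi * \<rho>)) = of_real (sinh (pi * \<rho>))"
    using sinh_conv_sin[of "of_real (pi * \<rho>)"] by (simp only: sinh_complex_of_real)
  have h: "sin (complex_of_real (pi / 2)) = 1" "cos (complex_of_real (pi / 2)) = 0"
    by (simp_all only: sin_of_real cos_of_real sin_pi_half cos_pi_half of_real_1 of_real_0)
  show "sin (of_real pi * crit \<rho>) = of_real (cosh (pi * \<rho>))"
    unfolding e sin_add h c by simp
  show "cos (of_real pi * crit \<rho>) = - \<i> * of_real (sinh (pi * \<rho>))"
    unfolding e cos_add h s[symmetric] by simp
qed

text \<open>Passes from the half argument, which occurs in the logarithmic derivative, to the full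
  one, for which sine and cosine on the critical line are hyperbolic functions.\<close>

lemma cot_half:
  fixes w :: complex
  assumes "sin w \<noteq> 0"
  shows "cot (w / 2) = (1 + cos w) / sin w"
proof -
  have s: "sin w = 2 * sin (w / 2) * cos (w / 2)" and c: "cos w = 2 * cos (w / 2) ^ 2 - 1"
    using sin_double[of "w / 2"] cos_double_cos[of "w / 2"] by simp_all
  show ?thesis using assms unfolding cot_def s c by (simp add: power2_eq_square)
qed

text \<open>The imaginary parts cancel: the reflection formula at \<open>crit \<rho>\<close>, where
  1 - s = cnj s, gives Im \<psi> = (pi / 2) tanh (pi \<rho>), while (pi / 2) cot (pi s / 2) has the
  opposite imaginary part. The cotangent also supplies the real summand pi / (2 cosh (pi
  \<rho>)).\<close>

lemma zeta_factor_log_derivative_crit: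
  "of_real (ln (2 * pi)) + of_real pi / 2 * cot (of_real pi * crit \<rho> / 2) - Digamma (1 - crit \<rho>)
     = of_real (2 * recip_f \<rho>)"
proof -
  define D where "D = Digamma (crit \<rho>)"
  define C where "C = cosh (pi * \<rho>)"
  define S where "S = sinh (pi * \<rho>)"
  have C: "C > 0" by (simp add: C_def)
  have s0: "crit \<rho> \<noteq> 0" using crit_not_Ints[of \<rho>] by (metis Ints_0)
  have D1: "Digamma (1 - crit \<rho>) = cnj D"
    unfolding one_minus_crit D_def using s0 by (rule Digamma_cnj)
  have cot1: "cot (of_real pi * crit \<rho>) = of_real (- S / C) * \<i>"
    using C unfolding cot_def sin_pi_crit cos_pi_crit C_def[symmetric] S_def[symmetric] by simp
  have "cot (of_real pi * crit \<rho> / 2) = (1 + cos (of_real pi * crit \<rho>)) / sin (of_real pi * crit \<rho>)"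
    using C by (intro cot_half) (simp add: sin_pi_crit C_def)
  hence cot2: "cot (of_real pi * crit \<rho> / 2) = Complex (1 / C) (- S / C)"
    using C unfolding sin_pi_crit cos_pi_crit C_def[symmetric] S_def[symmetric]
    by (simp add: complex_eq_iff)
  have "cnj D - D = of_real pi * cot (of_real pi * crit \<rho>)"
    using Digamma_reflection_complex[OF crit_not_Ints[of \<rho>]] unfolding D1 D_def[symmetric] .
  hence "Im (cnj D - D) = Im (of_real (pi * (- S / C)) * \<i>)"
    unfolding cot1 by (simp only: of_real_mult mult.assoc)
  hence "2 * Im D = pi * S / C" by simp
  hence ImD: "Im D = pi * S / C / 2" by (simp only: eq_divide_eq_numeral1 mult.commute) simp
  have r: "2 * recip_f \<rho> = ln (2 * pi) + pi / (2 * C) - Re D"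
    using C unfolding recip_f_def D_def[symmetric] C_def[symmetric] by (simp add: field_simps)
  show ?thesis unfolding D1 cot2 r
    by (simp add: complex_eq_iff ImD)
qed

lemma gammaF_nonzero: "gammaF \<rho> \<noteq> 0"
proof
  assume "gammaF \<rho> = 0"
  hence "1 / 4 + \<i> * complex_of_real \<rho> / 2 \<in> \<int>\<^sub>\<le>\<^sub>0" by (simp add: gammaF_def Gamma_eq_zero_iff)
  then obtain n where "n \<le> 0" "1 / 4 + \<i> * complex_of_real \<rho> / 2 = of_int n" by (auto elim: nonpos_Ints_cases)
  hence "Re (1 / 4 + \<i> * complex_of_real \<rho> / 2) = of_int n" by simp
  with \<open>n \<le> 0\<close> show False by simp
qed

text \<open>Legendre duplication at (1 - s) / 2 and reflection at s / 2 share the factor \<Gamma>(1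
  - s / 2), called \<open>H\<close>. Eliminating it turns the factor into pi^(s - 1/2) \<Gamma>((1 -
  s) / 2) / \<Gamma>(s / 2), and on the critical line the upper Gamma value is the conjugate of the
  lower one.\<close>

lemma zeta_factor_crit:
  "zeta_factor (crit \<rho>) = cis (\<rho> * ln pi) * cnj (gammaF \<rho>) / gammaF \<rho>"
proof -
  define s where "s = crit \<rho>"
  define F where "F = gammaF \<rho>"
  have F: "F = Gamma (s / 2)" by (simp add: F_def gammaF_def s_def crit_def add_divide_distrib)
  have Res: "Re s = 1 / 2" by (simp add: s_def crit_def)
  have nonpos: "z \<notin> \<int>\<^sub>\<le>\<^sub>0" if "Re z > 0" for z :: complex
    using that by (auto elim!: nonpos_Ints_cases)
  have F0: "F \<noteq> 0" unfolding F_def by (rule gammaF_nonzero)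
  have cF: "cnj F = Gamma ((1 - s) / 2)"
    unfolding F s_def one_minus_crit by (simp add: cnj_Gamma)
  define H where "H = Gamma (1 - s / 2)"
  have dup: "cnj F * H = exp (s * of_real (ln 2)) * of_real (sqrt pi) * Gamma (1 - s)"
  proof -
    have e: "(1 - s) / 2 + 1 / 2 = 1 - s / 2" "1 - (1 - s) = s" "2 * ((1 - s) / 2) = 1 - s"
      by (simp_all add: field_simps)
    have "(1 - s) / 2 \<notin> \<int>\<^sub>\<le>\<^sub>0" "(1 - s) / 2 + 1 / 2 \<notin> \<int>\<^sub>\<le>\<^sub>0" by (intro nonpos; simp add: Res)+
    from Gamma_legendre_duplication[OF this] show ?thesis unfolding e cF H_def .
  qed
  define Sn where "Sn = sin (of_real pi * s / 2)"
  have refl: "rGamma (s / 2) * rGamma (1 - s / 2) = Sn / of_real pi"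
    using rGamma_reflection_complex[of "s / 2"] by (simp add: Sn_def)
  have FH: "F * H * Sn = of_real pi"
  proof -
    have "F * rGamma (s / 2) = 1" "H * rGamma (1 - s / 2) = 1"
      unfolding F H_def using nonpos[of "s / 2"] nonpos[of "1 - s / 2"] Res
      by (simp_all add: Gamma_def rGamma_eq_zero_iff)
    hence "(F * H) * (rGamma (s / 2) * rGamma (1 - s / 2)) = 1" by algebra
    thus ?thesis unfolding refl by (simp add: divide_simps)
  qed
  \<comment> \<open>All constants are written as exponentials of real logarithms, which reduces the
    identity to one between exponents; s = 1/2 + i \<rho> splits the power of pi into sqrt pi and a
    phase.\<close>
  have ex: "2 * of_real (2 * pi) powr (s - 1) * of_real pi = cis (\<rho> * ln pi) * (exp (s * of_real (ln 2)) * of_real (sqrt pi))"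
  proof -
    have x: "complex_of_real x = exp (of_real (ln x))" if "x > 0" for x
      using that by (simp add: exp_of_real)
    have lsq: "ln (sqrt pi) = ln pi / 2" by (simp add: ln_sqrt)
    have "complex_of_real (sqrt pi) = exp (of_real (ln (sqrt pi)))" by (rule x) simp
    hence sq: "complex_of_real (sqrt pi) = exp (of_real (ln pi / 2))" by (simp only: lsq)
    have two: "(2 :: complex) = exp (of_real (ln 2))" using x[of 2] by simp
    have Ln: "Ln (of_real (2 * pi)) = of_real (ln 2 + ln pi)"
      by (subst Ln_of_real) (simp_all add: ln_mult)
    have "of_real (2 * pi) powr (s - 1) = exp ((s - 1) * of_real (ln 2 + ln pi))"
      unfolding powr_def Ln by simp
    hence "2 * of_real (2 * pi) powr (s - 1) * of_real pi =
        exp (of_real (ln 2)) * exp ((s - 1) * of_real (ln 2 + ln pi)) * exp (of_real (ln pi))"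
      using two x[of pi] by simp
    also have "\<dots> = exp (of_real (ln 2) + (s - 1) * of_real (ln 2 + ln pi) + of_real (ln pi))"
      by (simp only: exp_add)
    also have "of_real (ln 2) + (s - 1) * of_real (ln 2 + ln pi) + of_real (ln pi) =
        \<i> * of_real (\<rho> * ln pi) + (s * of_real (ln 2) + of_real (ln pi / 2))"
      by (simp add: s_def crit_def complex_eq_iff field_simps)
    also have "exp \<dots> = cis (\<rho> * ln pi) * (exp (s * of_real (ln 2)) * of_real (sqrt pi))"
      unfolding sq by (simp only: exp_add cis_conv_exp)
    finally show ?thesis .
  qed
  have sn0: "H \<noteq> 0" "Sn \<noteq> 0" using FH by auto
  have "zeta_factor s * F * H = 2 * of_real (2 * pi) powr (s - 1) * (F * H * Sn) * Gamma (1 - s)"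
    by (simp add: zeta_factor_def Sn_def)
  also have "\<dots> = cis (\<rho> * ln pi) * (cnj F * H)" unfolding FH ex dup by (simp only: mult.assoc)
  finally have "zeta_factor s * F = cis (\<rho> * ln pi) * cnj F" using sn0 by simp
  thus ?thesis using F0 by (simp add: field_simps s_def F_def)
qed

text \<open>Use cnj F / F = (cnj F)^2 / |F|^2. Replacing F_R^2 - F_I^2 by 2 F_R^2 - |F|^2 produces
  the isolated cosine and sine terms of the coefficients.\<close>

lemma zeta_factor_crit_Re_Im:
  "Re (zeta_factor (crit \<rho>)) = 2 * coeff_a \<rho> - 1" "Im (zeta_factor (crit \<rho>)) = 2 * coeff_b \<rho>"
proof -
  define F where "F = gammaF \<rho>"
  define L where "L = \<rho> * ln pi"
  define N where "N = (cmod F)\<^sup>2"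
  have N: "N > 0" using gammaF_nonzero[of \<rho>] by (simp add: N_def F_def)
  have N': "N = (Re F)\<^sup>2 + (Im F)\<^sup>2" by (simp add: N_def cmod_power2)
  have "zeta_factor (crit \<rho>) = cis L * cnj F / F" by (simp add: zeta_factor_crit F_def L_def)
  also have "\<dots> = cis L * (cnj F)\<^sup>2 / of_real N"
    unfolding N_def complex_norm_square by (simp add: power2_eq_square)
  finally have z: "zeta_factor (crit \<rho>) = cis L * (cnj F)\<^sup>2 / of_real N" .
  have "Re (zeta_factor (crit \<rho>)) = (cos L * ((Re F)\<^sup>2 - (Im F)\<^sup>2) + sin L * (2 * Re F * Im F)) / N"
    unfolding z Re_divide_of_real by (simp add: power2_eq_square algebra_simps)
  also have "\<dots> = 2 * coeff_a \<rho> - 1"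
    using N unfolding coeff_a_def F_def[symmetric] L_def[symmetric] N_def[symmetric]
    by (simp add: field_simps) (simp add: N' algebra_simps power2_eq_square)
  finally show "Re (zeta_factor (crit \<rho>)) = 2 * coeff_a \<rho> - 1" .
  have "Im (zeta_factor (crit \<rho>)) = (sin L * ((Re F)\<^sup>2 - (Im F)\<^sup>2) - cos L * (2 * Re F * Im F)) / N"
    unfolding z Im_divide_of_real by (simp add: power2_eq_square algebra_simps)
  also have "\<dots> = 2 * coeff_b \<rho>"
    using N unfolding coeff_b_def F_def[symmetric] L_def[symmetric] N_def[symmetric]
    by (simp add: field_simps) (simp add: N' algebra_simps power2_eq_square)
  finally show "Im (zeta_factor (crit \<rho>)) = 2 * coeff_b \<rho>" .
qed

lemma deriv_riemann_zeta_crit: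
  "deriv riemann_zeta (crit \<rho>) + zeta_factor (crit \<rho>) * cnj (deriv riemann_zeta (crit \<rho>)) =
     of_real (2 * recip_f \<rho>) * riemann_zeta (crit \<rho>)"
proof -
  define s where "s = crit \<rho>"
  have s: "0 < Re s" "Re s < 1" "s \<noteq> 1" "1 - s \<noteq> 1" "1 - s = cnj s"
    using one_minus_crit[of \<rho>] by (auto simp: s_def crit_def complex_eq_iff)
  have "(riemann_zeta has_field_derivative deriv riemann_zeta (1 - s)) (at (1 - s))"
    by (rule holomorphic_derivI[OF riemann_zeta_holomorphic]) (use s(4) in auto)
  hence "((\<lambda>s. riemann_zeta (1 - s)) has_field_derivative deriv riemann_zeta (1 - s) * (0 - 1)) (at s)"
    by (rule DERIV_chain2) (intro derivative_intros)
  \<comment> \<open>The sign comes from the inner derivative of 1 - s, the conjugate from 1 - s =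
    cnj s.\<close>
  hence d1: "((\<lambda>s. riemann_zeta (1 - s)) has_field_derivative - cnj (deriv riemann_zeta s)) (at s)"
    unfolding s(5) deriv_riemann_zeta_cnj[OF s(3)] by simp
  have d2: "(zeta_factor has_field_derivative zeta_factor s * of_real (2 * recip_f \<rho>)) (at s)"
    using zeta_factor_has_field_derivative[OF s(1,2)]
    unfolding s_def zeta_factor_log_derivative_crit .
  have "((\<lambda>s. zeta_factor s * riemann_zeta (1 - s)) has_field_derivative
      zeta_factor s * - cnj (deriv riemann_zeta s) + zeta_factor s * of_real (2 * recip_f \<rho>) * riemann_zeta (1 - s)) (at s)"
    by (rule DERIV_mult'[OF d2 d1])
  moreover have "open ({s. 0 < Re s} \<inter> {s. Re s < 1})"
    by (intro open_Int open_halfspace_Re_gt open_halfspace_Re_lt)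
  ultimately have "(riemann_zeta has_field_derivative
      zeta_factor s * - cnj (deriv riemann_zeta s) + zeta_factor s * of_real (2 * recip_f \<rho>) * riemann_zeta (1 - s)) (at s)"
  proof (rule has_field_derivative_transform_within_open)
    show "s \<in> {s. 0 < Re s} \<inter> {s. Re s < 1}" using s(1,2) by simp
    show "zeta_factor z * riemann_zeta (1 - z) = riemann_zeta z" if "z \<in> {s. 0 < Re s} \<inter> {s. Re s < 1}" for z
      using that by (intro riemann_zeta_functional_equation[symmetric]) auto
  qed
  hence "deriv riemann_zeta s =
      zeta_factor s * - cnj (deriv riemann_zeta s) + of_real (2 * recip_f \<rho>) * (zeta_factor s * riemann_zeta (1 - s))"
    by (subst DERIV_imp_deriv) (simp_all only: mult_ac)
  \<comment> \<open>A second use of the functional equation collapses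
    \<open>zeta_factor s * riemann_zeta (1 - s)\<close> to \<open>riemann_zeta s\<close>.\<close>
  thus ?thesis
    unfolding riemann_zeta_functional_equation[OF s(1,2), symmetric] unfolding s_def by (simp add: eq_diff_eq)
qed

theorem mainTheorem5:
  fixes \<rho> :: real
  assumes "\<rho> \<ge> 0"
  shows "zetaR \<rho> * recip_f \<rho> = coeff_a \<rho> * zetaR' \<rho> + coeff_b \<rho> * zetaI' \<rho>
    \<and> zetaI \<rho> * recip_f \<rho> = coeff_b \<rho> * zetaR' \<rho> + coeff_c \<rho> * zetaI' \<rho>
    \<and> coeff_a \<rho> * coeff_c \<rho> - (coeff_b \<rho>)\<^sup>2 = 0"
proof (intro conjI)
  note eq = deriv_riemann_zeta_crit[of \<rho>]
  \<comment> \<open>Real parts, with Re (\<chi> cnj w) = Re \<chi> Re w + Im \<chi> Im w for w =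
    \<zeta>'; the -1 in the real part of \<chi> cancels the first summand.\<close>
  have "zetaR' \<rho> + ((2 * coeff_a \<rho> - 1) * zetaR' \<rho> + 2 * coeff_b \<rho> * zetaI' \<rho>) = 2 * recip_f \<rho> * zetaR \<rho>"
    using arg_cong[OF eq, of Re] by (simp add: zetaR'_def zetaI'_def zetaR_def zeta_factor_crit_Re_Im)
  thus "zetaR \<rho> * recip_f \<rho> = coeff_a \<rho> * zetaR' \<rho> + coeff_b \<rho> * zetaI' \<rho>"
    by (simp add: algebra_simps)
  \<comment> \<open>In the imaginary parts the total coefficient of \<open>zetaI'\<close> is 1 - (2
    a - 1) = 2 (1 - a), twice \<open>coeff_c\<close>.\<close>
  have "zetaI' \<rho> + (2 * coeff_b \<rho> * zetaR' \<rho> - (2 * coeff_a \<rho> - 1) * zetaI' \<rho>) = 2 * recip_f \<rho> * zetaI \<rho>"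
    using arg_cong[OF eq, of Im] by (simp add: zetaR'_def zetaI'_def zetaI_def zeta_factor_crit_Re_Im)
  thus "zetaI \<rho> * recip_f \<rho> = coeff_b \<rho> * zetaR' \<rho> + coeff_c \<rho> * zetaI' \<rho>"
    by (simp add: coeff_c_def algebra_simps)
  have "cmod (zeta_factor (crit \<rho>)) = 1"
    unfolding zeta_factor_crit using gammaF_nonzero[of \<rho>] by (simp add: norm_mult norm_divide)
  \<comment> \<open>Expanded, this reads 4 (b^2 - a (1 - a)) = 0.\<close>
  hence "(2 * coeff_a \<rho> - 1)\<^sup>2 + (2 * coeff_b \<rho>)\<^sup>2 = 1"
    using cmod_power2[of "zeta_factor (crit \<rho>)"] by (simp add: zeta_factor_crit_Re_Im)
  thus "coeff_a \<rho> * coeff_c \<rho> - (coeff_b \<rho>)\<^sup>2 = 0"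
    by (simp add: coeff_c_def power2_eq_square algebra_simps)
qed

end
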